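(* Let $G$ be a reduced sp-group with torsion subgroup $T$. Then $G$ is uniformly strongly Hopfian if and only if $T$ is strongly Hopfian; and likewise $G$ is uniformly strongly Hopfian if and only if $T$ is uniformly strongly Hopfian.
   Context: All groups are abelian and written additively. $\mathbb N$ denotes the positive integers. A group $G$ is strongly Hopfian (SH) if for every endomorphism $\phi$ of $G$ there is $n\in\mathbb N$ such that $\phi$ restricted to $\phi^n(G)$ is injective (equivalently, $\ker\phi^n=\ker\phi^m$ for all $m\ge n$); such an $n$ is called an SH-exponent for $\phi$. $G$ is uniformly SH if a single $n\in\mathbb N$ is an SH-exponent for all endomorphisms of $G$. For a group $G$ with torsion subgroup $T$ and $p$-torsion subgroups $T_p$ (so $T=\bigoplus_p T_p$, $p$ ranging over the primes), put $P=\prod_p T_p$. $G$ is an sp-group if it is isomorphic to a group $G'$ with $T\le G'\le P$ and $G'/T$ divisible; equivalently, the inclusion $T\hookrightarrow P$ extends to a pure embedding $G\hookrightarrow P$. A group is reduced if it has no nonzero divisible subgroup. *)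

theory Defs
  imports "HOL-Algebra.Product_Groups" "HOL-Computational_Algebra.Primes"
begin

text \<open>
  Abelian groups are rendered as \<open>comm_group\<close>, so the additive notation \<open>n x\<close> becomes \<open>x [^] n\<close>.
  A subgroup \<open>H\<close> of \<open>G\<close>, viewed as a group in its own right, is \<open>G\<lparr>carrier := H\<rparr>\<close>.
\<close>

definition SH_exponent :: "('a, 'b) monoid_scheme \<Rightarrow> ('a \<Rightarrow> 'a) \<Rightarrow> nat \<Rightarrow> bool"
  where "SH_exponent G \<phi> n \<longleftrightarrow> n > 0 \<and> inj_on \<phi> ((\<phi> ^^ n) ` carrier G)"

definition strongly_Hopfian :: "('a, 'b) monoid_scheme \<Rightarrow> bool"
  where "strongly_Hopfian G \<longleftrightarrow> (\<forall>\<phi> \<in> hom G G. \<exists>n. SH_exponent G \<phi> n)"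

definition uniformly_strongly_Hopfian :: "('a, 'b) monoid_scheme \<Rightarrow> bool"
  where "uniformly_strongly_Hopfian G \<longleftrightarrow> (\<exists>n. \<forall>\<phi> \<in> hom G G. SH_exponent G \<phi> n)"

definition torsion_group :: "('a, 'b) monoid_scheme \<Rightarrow> ('a, 'b) monoid_scheme"
  where "torsion_group G =
    G\<lparr>carrier := {x \<in> carrier G. \<exists>n::nat. n > 0 \<and> x [^]\<^bsub>G\<^esub> n = \<one>\<^bsub>G\<^esub>}\<rparr>"

definition p_torsion_group :: "('a, 'b) monoid_scheme \<Rightarrow> nat \<Rightarrow> ('a, 'b) monoid_scheme"
  where "p_torsion_group G p =
    G\<lparr>carrier := {x \<in> carrier G. \<exists>k::nat. x [^]\<^bsub>G\<^esub> (p ^ k) = \<one>\<^bsub>G\<^esub>}\<rparr>"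

definition divisible_group :: "('a, 'b) monoid_scheme \<Rightarrow> bool"
  where "divisible_group G \<longleftrightarrow>
    (\<forall>x \<in> carrier G. \<forall>n::nat. n > 0 \<longrightarrow> (\<exists>y \<in> carrier G. y [^]\<^bsub>G\<^esub> n = x))"

definition reduced_group :: "('a, 'b) monoid_scheme \<Rightarrow> bool"
  where "reduced_group G \<longleftrightarrow>
    (\<forall>H. subgroup H G \<and> divisible_group (G\<lparr>carrier := H\<rparr>) \<longrightarrow> H = {\<one>\<^bsub>G\<^esub>})"

text \<open>
  Inside the product \<open>P\<close> of the \<open>p\<close>-torsion subgroups of \<open>G\<close>, the torsion subgroup
  \<open>T\<close> (the direct sum of the \<open>p\<close>-torsion subgroups) is the set of families of finite support,
  i.e. the carrier of the library's \<open>sum_group\<close>.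
\<close>

definition sp_group :: "('a, 'b) monoid_scheme \<Rightarrow> bool"
  where "sp_group G \<longleftrightarrow>
    (let P = product_group {p. Factorial_Ring.prime p} (p_torsion_group G);
         T = carrier (sum_group {p. Factorial_Ring.prime p} (p_torsion_group G))
     in \<exists>G'. subgroup G' P \<and> T \<subseteq> G' \<and>
          divisible_group (P\<lparr>carrier := G'\<rparr> Mod T) \<and> G \<cong> P\<lparr>carrier := G'\<rparr>)"

end

theory Submission
  imports Defs
begin

text \<open>
  Write \<open>T\<close> for the torsion subgroup of \<open>G\<close> and \<open>T_p\<close> for its \<open>p\<close>-torsion part. An isomorphism of \<open>G\<close>
  with a group between \<open>T\<close> and the product of the \<open>T_p\<close> provides, for every prime \<open>p\<close>, a projection
  \<open>\<pi>_p\<close> of \<open>G\<close> onto \<open>T_p\<close>; the projections jointly separate the points of \<open>G\<close>, and every element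
  of \<open>G\<close> is an \<open>n\<close>-th power up to an element of \<open>T\<close>. This is the locale \<open>primary_projections\<close>, and the
  argument uses nothing else about \<open>G\<close>. For an endomorphism, an SH-exponent is a number \<open>n > 0\<close> at
  which the chain of kernels has stopped (\<open>SH_exponent_iff_kernels\<close>).

  If \<open>G\<close> has a uniform exponent \<open>n\<close>, then so has every \<open>T_p\<close>, because an endomorphism of \<open>T_p\<close> extends
  to \<open>G\<close> by composing it with \<open>\<pi>_p\<close>. Endomorphisms of \<open>T\<close> commute with all \<open>\<pi>_p\<close>, and the \<open>\<pi>_p\<close>
  separate points, so \<open>n\<close> is a uniform exponent for \<open>T\<close>; in particular \<open>T\<close> is strongly Hopfian.

  Conversely let \<open>T\<close> be strongly Hopfian. The endomorphism \<open>x \<mapsto> x ^ p\<close> of \<open>T\<close> shows that \<open>T_p\<close> is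
  bounded, and \<open>T_p\<close> is strongly Hopfian as a retract of \<open>T\<close>. A bounded strongly Hopfian \<open>p\<close>-group is
  finite (\<open>bounded_strongly_Hopfian_imp_finite\<close>), hence uniformly strongly Hopfian. Choosing in each
  \<open>T_p\<close> an endomorphism that needs the largest exponent and gluing these choices to one endomorphism
  of \<open>T\<close> yields a bound on the exponents that is independent of \<open>p\<close>. Finally an endomorphism \<open>f\<close> of \<open>G\<close>
  commutes with \<open>\<pi>_p\<close>: if \<open>p ^ k\<close> annihilates \<open>T_p\<close> and \<open>x = y ^ (p ^ k) t\<close> with \<open>t\<close> in \<open>T\<close>, then
  \<open>\<pi>_p x = \<pi>_p t\<close> and \<open>\<pi>_p (f x) = \<pi>_p (f t)\<close>, which reduces the claim to \<open>T\<close>. So the common exponent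
  of the \<open>T_p\<close> is one for \<open>G\<close>.

  For the finiteness of a bounded strongly Hopfian \<open>p\<close>-group \<open>A\<close>, suppose that \<open>A\<close> is infinite, and let
  \<open>j\<close> be maximal with infinitely many \<open>p ^ j\<close>-th powers in \<open>A\<close>. Then there are infinitely many
  \<open>p ^ j\<close>-th powers of elements of order dividing \<open>p ^ (j + 1)\<close>, while the group of \<open>p ^ (j + 1)\<close>-th
  powers is finite. Hence elements \<open>a_0, a_1, ...\<close> of order \<open>p ^ (j + 1)\<close> can be chosen one after the
  other, each independent of the finitely many elements constructed so far, and \<open>a_0 \<mapsto> 1\<close>,
  \<open>a_(n+1) \<mapsto> a_n\<close>, \<open>x ^ (p ^ (j + 1)) \<mapsto> 1\<close> is a partial homomorphism. It extends to all of \<open>A\<close> by Zorn's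
  lemma, since its range behaves like an injective module over the integers modulo \<open>p ^ (j + 1)\<close>.
  The kernels of the powers of this shift never stop growing.
\<close>

section \<open>Adjoining an element to a subgroup\<close>

text \<open>The product of a subgroup \<open>H\<close> and the cyclic subgroup generated by \<open>g\<close>.\<close>

definition adjoin :: "('a, 'b) monoid_scheme \<Rightarrow> 'a set \<Rightarrow> 'a \<Rightarrow> 'a set"
  where "adjoin G H g = {h \<otimes>\<^bsub>G\<^esub> g [^]\<^bsub>G\<^esub> m | h (m :: int). h \<in> H}"

lemma (in comm_group) subgroup_adjoin:
  assumes "subgroup H G" "g \<in> carrier G"
  shows "subgroup (adjoin G H g) G"
proof -
  have "adjoin G H g = H <#> generate G {g}"
    using generate_pow[OF assms(2)] by (auto simp: adjoin_def set_mult_def)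
  moreover have "subgroup (generate G {g}) G"
    using assms(2) by (intro generate_is_subgroup) auto
  ultimately show ?thesis
    using mult_subgroups[OF assms(1)] by simp
qed

lemma (in group) adjoin_superset:
  assumes "subgroup H G" "g \<in> carrier G"
  shows "H \<subseteq> adjoin G H g"
proof
  fix h assume h: "h \<in> H"
  then have "h = h \<otimes> g [^] (0::int)"
    using subgroup.mem_carrier[OF assms(1)] by simp
  with h show "h \<in> adjoin G H g" unfolding adjoin_def by blast
qed

lemma (in group) adjoin_self:
  assumes "subgroup H G" "g \<in> carrier G"
  shows "g \<in> adjoin G H g"
proof -
  have "g = \<one> \<otimes> g [^] (1::int)"
    using assms(2) by simp
  with subgroup.one_closed[OF assms(1)] show ?thesis unfolding adjoin_def by blast
qed

lemma (in group) finite_adjoin: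
  assumes "finite H" "g \<in> carrier G" "g [^] N = \<one>" "N > (0::nat)"
  shows "finite (adjoin G H g)"
proof -
  have "g [^] m \<in> (\<lambda>i. g [^] i) ` {0..<int N}" for m :: int
  proof -
    have "g [^] (int N * (m div int N) + m mod int N) = (g [^] int N) [^] (m div int N) \<otimes> g [^] (m mod int N)"
      using assms(2) by (simp only: int_pow_mult int_pow_pow int_pow_closed)
    moreover have "g [^] int N = \<one>" using assms(3) by (simp add: int_pow_int)
    ultimately have "g [^] m = g [^] (m mod int N)" using assms(2) by simp
    moreover have "m mod int N \<in> {0..<int N}" using assms(4) by simp
    ultimately show ?thesis by blast
  qed
  then have "adjoin G H g \<subseteq> (\<lambda>(h, c). h \<otimes> c) ` (H \<times> (\<lambda>i. g [^] i) ` {0..<int N})"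
    unfolding adjoin_def by fast
  then show ?thesis
    by (rule finite_subset) (use assms(1) in auto)
qed

text \<open>
  The integers \<open>m\<close> with \<open>a [^] m\<close> in \<open>D\<close> form an ideal. It contains \<open>p ^ Suc j\<close> but not \<open>p ^ j\<close>, so its
  generator, a divisor of \<open>p ^ Suc j\<close>, is \<open>p ^ Suc j\<close> itself.
\<close>

lemma (in group) prime_power_dvd_exponent:
  fixes p j :: nat and m :: int
  assumes D: "subgroup D G" and a: "a \<in> carrier G" and p: "Factorial_Ring.prime p"
    and in1: "a [^] (p ^ Suc j) \<in> D" and nin: "a [^] (p ^ j) \<notin> D" and m: "a [^] m \<in> D"
  shows "int (p ^ Suc j) dvd m"
proof -
  let ?q = "int (p ^ Suc j)"
  define d where "d = nat (gcd m ?q)"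
  have di: "int d = gcd m ?q" by (simp add: d_def)
  obtain u v where uv: "u * m + v * ?q = int d"
    using bezout_int di by metis
  have "a [^] (int d) = (a [^] m) [^] u \<otimes> (a [^] ?q) [^] v"
    using a by (simp add: uv[symmetric] int_pow_mult int_pow_pow mult.commute)
  also have "\<dots> \<in> D"
    using in1 by (intro subgroup.m_closed[OF D] subgroup_int_pow_closed[OF D m]
        subgroup_int_pow_closed[OF D, of "a [^] ?q"]) (simp only: int_pow_int)
  finally have adD: "a [^] d \<in> D" by (simp add: int_pow_int)
  have "d dvd p ^ Suc j"
    using di by (metis gcd_dvd2 int_dvd_int_iff)
  then obtain i where i: "i \<le> Suc j" "d = p ^ i"
    using divides_primepow_nat[OF p] by blast
  have "i = Suc j"
  proof (rule ccontr)
    assume "i \<noteq> Suc j"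
    with i have "p ^ j = d * p ^ (j - i)" by (simp flip: power_add)
    then have "a [^] (p ^ j) = (a [^] d) [^] int (p ^ (j - i))"
      using a by (simp only: nat_pow_pow int_pow_int)
    with nin subgroup_int_pow_closed[OF D adD] show False by simp
  qed
  then show ?thesis using i di by (metis gcd_dvd1)
qed

section \<open>Partial endomorphisms and their extension\<close>

text \<open>
  The graph of a homomorphism from a subgroup of \<open>G\<close> to \<open>G\<close>, encoded as a subgroup of \<open>G \<times>\<times> G\<close>. For
  a subgroup, single-valuedness need only be required at \<open>\<one>\<close>.
\<close>

definition hom_graph :: "('a, 'b) monoid_scheme \<Rightarrow> ('a \<times> 'a) set \<Rightarrow> bool"
  where "hom_graph G \<Gamma> \<longleftrightarrow> subgroup \<Gamma> (G \<times>\<times> G) \<and> (\<forall>y. (\<one>\<^bsub>G\<^esub>, y) \<in> \<Gamma> \<longrightarrow> y = \<one>\<^bsub>G\<^esub>)"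

lemma DirProd_comm_group:
  assumes "comm_group G" "comm_group H"
  shows "comm_group (G \<times>\<times> H)"
proof -
  interpret G: comm_group G by fact
  interpret H: comm_group H by fact
  interpret GH: group "G \<times>\<times> H" by (rule DirProd_group) unfold_locales
  show ?thesis
    by (rule GH.group_comm_groupI) (auto simp: G.m_comm H.m_comm)
qed

lemma DirProd_int_pow:
  assumes "group G" "group H" "a \<in> carrier G" "b \<in> carrier H"
  shows "(a, b) [^]\<^bsub>G \<times>\<times> H\<^esub> (m :: int) = (a [^]\<^bsub>G\<^esub> m, b [^]\<^bsub>H\<^esub> m)"
proof -
  interpret G: group G by fact
  interpret H: group H by fact
  interpret GH: group "G \<times>\<times> H" by (rule DirProd_group) unfold_locales
  have "fst \<in> hom (G \<times>\<times> H) G" "snd \<in> hom (G \<times>\<times> H) H"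
    by (auto simp: hom_def mult_DirProd')
  then have "fst ((a, b) [^]\<^bsub>G \<times>\<times> H\<^esub> m) = a [^]\<^bsub>G\<^esub> m" "snd ((a, b) [^]\<^bsub>G \<times>\<times> H\<^esub> m) = b [^]\<^bsub>H\<^esub> m"
    using assms by (simp_all add: hom_int_pow)
  then show ?thesis by (metis prod.collapse)
qed

context comm_group
begin

lemma mem_adjoin_DirProd:
  assumes "a \<in> carrier G" "b \<in> carrier G"
  shows "(u, v) \<in> adjoin (G \<times>\<times> G) \<Gamma> (a, b) \<longleftrightarrow>
    (\<exists>x y. \<exists>m :: int. (x, y) \<in> \<Gamma> \<and> u = x \<otimes> a [^] m \<and> v = y \<otimes> b [^] m)"
  using assms by (auto simp: adjoin_def DirProd_int_pow[OF is_group is_group])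

lemma hom_graph_subgroups:
  assumes "hom_graph G \<Gamma>"
  shows "subgroup (fst ` \<Gamma>) G" "subgroup (snd ` \<Gamma>) G"
proof -
  have "group_hom (G \<times>\<times> G) G fst" "group_hom (G \<times>\<times> G) G snd"
    by (auto intro!: group_hom.intro group_hom_axioms.intro DirProd_group is_group
          simp: hom_def mult_DirProd')
  with assms show "subgroup (fst ` \<Gamma>) G" "subgroup (snd ` \<Gamma>) G"
    by (auto simp: hom_graph_def intro: group_hom.subgroup_img_is_subgroup)
qed

lemma hom_graph_adjoin:
  assumes "hom_graph G \<Gamma>" "a \<in> carrier G" "b \<in> carrier G"
    and "\<And>x y m. (x, y) \<in> \<Gamma> \<Longrightarrow> x \<otimes> a [^] (m :: int) = \<one> \<Longrightarrow> y \<otimes> b [^] m = \<one>"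
  shows "hom_graph G (adjoin (G \<times>\<times> G) \<Gamma> (a, b))"
  unfolding hom_graph_def
proof
  interpret GG: comm_group "G \<times>\<times> G"
    by (intro DirProd_comm_group comm_group_axioms)
  show "subgroup (adjoin (G \<times>\<times> G) \<Gamma> (a, b)) (G \<times>\<times> G)"
    using assms by (intro GG.subgroup_adjoin) (auto simp: hom_graph_def)
  show "\<forall>y. (\<one>, y) \<in> adjoin (G \<times>\<times> G) \<Gamma> (a, b) \<longrightarrow> y = \<one>"
    using assms(2-4) by (auto simp: mem_adjoin_DirProd)
qed

lemma snd_adjoin_DirProd:
  assumes "a \<in> carrier G" "b \<in> carrier G"
  shows "snd ` adjoin (G \<times>\<times> G) \<Gamma> (a, b) = adjoin G (snd ` \<Gamma>) b"
proof (intro equalityI subsetI)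
  fix v assume "v \<in> snd ` adjoin (G \<times>\<times> G) \<Gamma> (a, b)"
  then obtain u where "(u, v) \<in> adjoin (G \<times>\<times> G) \<Gamma> (a, b)" by auto
  with assms show "v \<in> adjoin G (snd ` \<Gamma>) b"
    unfolding mem_adjoin_DirProd[OF assms] by (force simp: adjoin_def)
next
  fix v assume "v \<in> adjoin G (snd ` \<Gamma>) b"
  then obtain x y and m :: int where "(x, y) \<in> \<Gamma>" "v = y \<otimes> b [^] m"
    by (auto simp: adjoin_def)
  then have "(x \<otimes> a [^] m, v) \<in> adjoin (G \<times>\<times> G) \<Gamma> (a, b)"
    using assms by (auto simp: mem_adjoin_DirProd)
  then show "v \<in> snd ` adjoin (G \<times>\<times> G) \<Gamma> (a, b)" by force
qed

lemma hom_graph_Union: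
  assumes "C \<noteq> {}" and C: "\<And>\<Delta>. \<Delta> \<in> C \<Longrightarrow> hom_graph G \<Delta>"
    and chain: "\<And>X Y. X \<in> C \<Longrightarrow> Y \<in> C \<Longrightarrow> X \<subseteq> Y \<or> Y \<subseteq> X"
  shows "hom_graph G (\<Union>C)"
proof -
  interpret GG: group "G \<times>\<times> G"
    by (intro DirProd_group is_group)
  have sub: "subgroup \<Delta> (G \<times>\<times> G)" if "\<Delta> \<in> C" for \<Delta>
    using C[OF that] by (simp add: hom_graph_def)
  have "subgroup (\<Union>C) (G \<times>\<times> G)"
  proof (rule GG.subgroupI)
    show "\<Union>C \<subseteq> carrier (G \<times>\<times> G)"
      using sub subgroup.subset by blast
    show "\<Union>C \<noteq> {}"
      using assms(1) sub subgroup.one_closed by blast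
    fix a b assume ab: "a \<in> \<Union>C" "b \<in> \<Union>C"
    from ab(1) obtain X where X: "X \<in> C" "a \<in> X" ..
    then have "inv\<^bsub>G \<times>\<times> G\<^esub> a \<in> X"
      by (intro subgroup.m_inv_closed[OF sub])
    with X show "inv\<^bsub>G \<times>\<times> G\<^esub> a \<in> \<Union>C" by blast
    from ab(2) obtain Y where Y: "Y \<in> C" "b \<in> Y" ..
    from chain[OF X(1) Y(1)] X Y obtain Z where Z: "Z \<in> C" "a \<in> Z" "b \<in> Z"
      by blast
    then have "a \<otimes>\<^bsub>G \<times>\<times> G\<^esub> b \<in> Z"
      by (intro subgroup.m_closed[OF sub])
    with Z show "a \<otimes>\<^bsub>G \<times>\<times> G\<^esub> b \<in> \<Union>C" by blast
  qed
  then show ?thesis using C by (auto simp: hom_graph_def)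
qed

lemma hom_graph_total:
  assumes "hom_graph G \<Gamma>" "fst ` \<Gamma> = carrier G"
  obtains f where "f \<in> hom G G" "\<And>x y. (x, y) \<in> \<Gamma> \<Longrightarrow> f x = y"
proof -
  interpret GG: group "G \<times>\<times> G"
    by (intro DirProd_group is_group)
  have sub: "subgroup \<Gamma> (G \<times>\<times> G)" and one: "\<And>y. (\<one>, y) \<in> \<Gamma> \<Longrightarrow> y = \<one>"
    using assms(1) by (auto simp: hom_graph_def)
  have in_carr: "x \<in> carrier G" "y \<in> carrier G" if "(x, y) \<in> \<Gamma>" for x y
    using subgroup.subset[OF sub] that by auto
  have uniq: "y = z" if "(x, y) \<in> \<Gamma>" "(x, z) \<in> \<Gamma>" for x y z
  proof -
    have "(x, y) \<otimes>\<^bsub>G \<times>\<times> G\<^esub> inv\<^bsub>G \<times>\<times> G\<^esub> (x, z) \<in> \<Gamma>"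
      using that by (intro subgroup.m_closed[OF sub] subgroup.m_inv_closed[OF sub])
    then have "(\<one>, y \<otimes> inv z) \<in> \<Gamma>"
      using in_carr that by (simp add: inv_DirProd is_group)
    from one[OF this] show ?thesis
      using in_carr that by (metis inv_closed inv_equality inv_inv)
  qed
  define f where "f x = (THE y. (x, y) \<in> \<Gamma>)" for x
  have f: "f x = y" if "(x, y) \<in> \<Gamma>" for x y
    unfolding f_def using that uniq by blast
  have "f \<in> hom G G"
  proof (rule homI)
    fix x assume "x \<in> carrier G"
    then obtain y where "(x, y) \<in> \<Gamma>" using assms(2) by (metis imageE prod.collapse)
    then show "f x \<in> carrier G" using f in_carr by metis
    fix x' assume "x' \<in> carrier G"
    then obtain y' where y': "(x', y') \<in> \<Gamma>" using assms(2) by (metis imageE prod.collapse)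
    have "(x \<otimes> x', y \<otimes> y') \<in> \<Gamma>"
      using subgroup.m_closed[OF sub \<open>(x, y) \<in> \<Gamma>\<close> y'] by simp
    then show "f (x \<otimes> x') = f x \<otimes> f x'"
      using f y' \<open>(x, y) \<in> \<Gamma>\<close> by metis
  qed
  with f that show ?thesis by blast
qed

text \<open>
  The hypothesis \<open>div\<close> is the divisibility property of a direct sum of cyclic groups of order
  \<open>p ^ Suc j\<close>, which makes it injective among abelian groups of exponent \<open>p ^ Suc j\<close>. By \<open>kills\<close> the
  partial homomorphism factors through the quotient by the \<open>p ^ Suc j\<close>-th powers, so it is enough that
  its range has this property.
\<close>

lemma hom_graph_extends_to_endomorphism:
  assumes p: "Factorial_Ring.prime (p :: nat)"
    and tors: "\<And>x. x \<in> carrier G \<Longrightarrow> \<exists>i. x [^] (p ^ i) = \<one>"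
    and graph: "hom_graph G \<Gamma>"
    and kills: "\<And>x. x \<in> carrier G \<Longrightarrow> (x [^] (p ^ Suc j), \<one>) \<in> \<Gamma>"
    and div: "\<And>y. y \<in> snd ` \<Gamma> \<Longrightarrow> y [^] (p ^ j) = \<one> \<Longrightarrow> \<exists>z \<in> snd ` \<Gamma>. y = z [^] p"
  obtains f where "f \<in> hom G G" "\<And>x y. (x, y) \<in> \<Gamma> \<Longrightarrow> f x = y"
proof -
  \<comment> \<open>The range must not grow, as \<open>div\<close> is known for the range of \<open>\<Gamma>\<close> only.\<close>
  define \<A> where "\<A> = {\<Delta>. hom_graph G \<Delta> \<and> \<Gamma> \<subseteq> \<Delta> \<and> snd ` \<Delta> \<subseteq> snd ` \<Gamma>}"
  have "\<exists>M\<in>\<A>. \<forall>X\<in>\<A>. M \<subseteq> X \<longrightarrow> X = M"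
  proof (rule subset_Zorn_nonempty)
    show "\<A> \<noteq> {}" using graph by (auto simp: \<A>_def)
    fix C assume C: "C \<noteq> {}" "subset.chain \<A> C"
    then have sub: "C \<subseteq> \<A>" and chain: "\<And>X Y. X \<in> C \<Longrightarrow> Y \<in> C \<Longrightarrow> X \<subseteq> Y \<or> Y \<subseteq> X"
      by (auto simp: subset_chain_def)
    have "hom_graph G (\<Union>C)"
      using sub chain by (intro hom_graph_Union C(1)) (auto simp: \<A>_def)
    moreover have "\<Gamma> \<subseteq> \<Union>C"
      using C(1) sub by (auto simp: \<A>_def)
    moreover have "snd ` \<Union>C \<subseteq> snd ` \<Gamma>"
      using sub unfolding \<A>_def by blast
    ultimately show "\<Union>C \<in> \<A>" by (simp add: \<A>_def)
  qed
  then obtain \<Delta> where "\<Delta> \<in> \<A>" and max: "\<And>X. X \<in> \<A> \<Longrightarrow> \<Delta> \<subseteq> X \<Longrightarrow> X = \<Delta>" by blast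
  then have \<Delta>: "hom_graph G \<Delta>" "\<Gamma> \<subseteq> \<Delta>" "snd ` \<Delta> \<subseteq> snd ` \<Gamma>" by (auto simp: \<A>_def)
  interpret GG: comm_group "G \<times>\<times> G"
    by (intro DirProd_comm_group comm_group_axioms)
  have sub: "subgroup \<Delta> (G \<times>\<times> G)" and one: "\<And>y. (\<one>, y) \<in> \<Delta> \<Longrightarrow> y = \<one>"
    using \<Delta>(1) by (auto simp: hom_graph_def)
  note dom = hom_graph_subgroups(1)[OF \<Delta>(1)]
  note ran = hom_graph_subgroups(2)[OF graph]
  have in_carr: "x \<in> carrier G" "y \<in> carrier G" if "(x, y) \<in> \<Delta>" for x y
    using subgroup.subset[OF sub] that by auto
  have pow: "(x [^] m, y [^] m) \<in> \<Delta>" if "(x, y) \<in> \<Delta>" for x y and m :: int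
    using GG.subgroup_int_pow_closed[OF sub that, of m] in_carr[OF that]
    by (simp add: DirProd_int_pow is_group)
  have "fst ` \<Delta> = carrier G"
  proof (rule ccontr)
    assume "fst ` \<Delta> \<noteq> carrier G"
    then obtain c where c: "c \<in> carrier G" "c \<notin> fst ` \<Delta>"
      using subgroup.subset[OF dom] by blast
    \<comment> \<open>Replace \<open>c\<close> by a power \<open>a\<close> outside the domain whose \<open>p\<close>-th power lies in the domain.\<close>
    define i where "i = (LEAST i. c [^] (p ^ i) \<in> fst ` \<Delta>)"
    have "\<exists>i. c [^] (p ^ i) \<in> fst ` \<Delta>"
      using tors[OF c(1)] subgroup.one_closed[OF dom] by metis
    then have i: "c [^] (p ^ i) \<in> fst ` \<Delta>" unfolding i_def by (rule LeastI_ex)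
    have "i \<noteq> 0"
      using i c by (intro notI) simp
    define a where "a = c [^] (p ^ (i - 1))"
    have a: "a \<in> carrier G" using c by (simp add: a_def)
    have "a \<notin> fst ` \<Delta>"
      using not_less_Least[of "i - 1" "\<lambda>i. c [^] (p ^ i) \<in> fst ` \<Delta>"] \<open>i \<noteq> 0\<close>
      by (simp add: a_def i_def)
    have ap: "a [^] p = c [^] (p ^ i)"
      using c \<open>i \<noteq> 0\<close> by (simp add: a_def nat_pow_pow power_eq_if mult.commute)
    with i obtain b where b: "(a [^] p, b) \<in> \<Delta>" by (metis imageE prod.collapse)
    have bc: "b \<in> carrier G" using in_carr[OF b] by simp
    have "((a [^] p) [^] int (p ^ j), b [^] int (p ^ j)) \<in> \<Delta>"
      using pow[OF b] .
    then have b1: "(a [^] (p ^ Suc j), b [^] (p ^ j)) \<in> \<Delta>"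
      using a by (simp only: int_pow_int nat_pow_pow power_Suc)
    have "(a [^] (p ^ Suc j), \<one>) \<in> \<Delta>" using kills[OF a] \<Delta>(2) by blast
    have "b [^] (p ^ j) = \<one>"
    proof -
      have "(a [^] (p ^ Suc j), b [^] (p ^ j)) \<otimes>\<^bsub>G \<times>\<times> G\<^esub> inv\<^bsub>G \<times>\<times> G\<^esub> (a [^] (p ^ Suc j), \<one>) \<in> \<Delta>"
        by (intro subgroup.m_closed[OF sub] subgroup.m_inv_closed[OF sub]) fact+
      then have "(\<one>, b [^] (p ^ j)) \<in> \<Delta>"
        using a bc by (simp add: inv_DirProd is_group)
      then show ?thesis by (rule one)
    qed
    moreover have "b \<in> snd ` \<Gamma>" using b \<Delta>(3) by force
    ultimately obtain b' where b': "b' \<in> snd ` \<Gamma>" "b = b' [^] p"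
      using div by blast
    have b'c: "b' \<in> carrier G" using b'(1) subgroup.subset[OF ran] by blast
    \<comment> \<open>Sending \<open>a\<close> to the \<open>p\<close>-th root \<open>b'\<close> of \<open>b\<close> is consistent with \<open>\<Delta>\<close>.\<close>
    let ?\<Delta> = "adjoin (G \<times>\<times> G) \<Delta> (a, b')"
    have "hom_graph G ?\<Delta>"
    proof (rule hom_graph_adjoin)
      fix x y and m :: int assume xy: "(x, y) \<in> \<Delta>" and eq: "x \<otimes> a [^] m = \<one>"
      note xyc = in_carr[OF xy]
      have "a [^] m = inv x"
        using eq xyc a by (metis int_pow_closed inv_equality m_comm inv_inv)
      also have "\<dots> \<in> fst ` \<Delta>"
        using xy by (intro subgroup.m_inv_closed[OF dom]) force
      finally have "int (p ^ Suc 0) dvd m"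
        using \<open>a \<notin> fst ` \<Delta>\<close> i ap a
        by (intro prime_power_dvd_exponent[OF dom a p]) simp_all
      then obtain m' where m': "m = int p * m'" by auto
      have "(a [^] m, b' [^] m) \<in> \<Delta>"
        using pow[OF b, of m'] a b'c by (simp add: b'(2) m' int_pow_pow flip: int_pow_int)
      from subgroup.m_closed[OF sub xy this] have "(\<one>, y \<otimes> b' [^] m) \<in> \<Delta>"
        by (simp add: eq)
      then show "y \<otimes> b' [^] m = \<one>" by (rule one)
    qed (use \<Delta> a b'c in auto)
    moreover have "\<Delta> \<subseteq> ?\<Delta>"
      using a b'c by (intro GG.adjoin_superset sub) simp
    moreover have "snd ` ?\<Delta> \<subseteq> snd ` \<Gamma>"
    proof -
      have "y \<otimes> b' [^] m \<in> snd ` \<Gamma>" if "y \<in> snd ` \<Delta>" for y and m :: int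
        using that \<Delta>(3) b'(1) by (intro subgroup.m_closed[OF ran] subgroup_int_pow_closed[OF ran]) auto
      then show ?thesis
        unfolding snd_adjoin_DirProd[OF a b'c] by (auto simp: adjoin_def)
    qed
    ultimately have "?\<Delta> = \<Delta>"
      using \<Delta>(2) by (intro max) (auto simp: \<A>_def)
    moreover have "(a, b') \<in> ?\<Delta>"
      using a b'c by (intro GG.adjoin_self sub) simp
    ultimately show False using \<open>a \<notin> fst ` \<Delta>\<close> by force
  qed
  from hom_graph_total[OF \<Delta>(1) this] \<Delta>(2) that show ?thesis by (metis subsetD)
qed

end

section \<open>Exponents and kernels\<close>

lemma hom_funpow:
  assumes "\<phi> \<in> hom G G"
  shows "(\<phi> ^^ n) \<in> hom G G"
proof (induction n)
  case 0
  show ?case by (simp add: hom_def)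
next
  case (Suc n)
  then show ?case using assms by (auto simp: hom_def Pi_iff)
qed

lemma SH_exponent_mono:
  assumes "\<phi> \<in> hom G G" "SH_exponent G \<phi> n" "n \<le> m"
  shows "SH_exponent G \<phi> m"
proof -
  have "\<phi> ^^ m = (\<phi> ^^ n) \<circ> (\<phi> ^^ (m - n))"
    using assms(3) by (simp flip: funpow_add)
  then have "(\<phi> ^^ m) ` carrier G = (\<phi> ^^ n) ` (\<phi> ^^ (m - n)) ` carrier G"
    by (simp only: image_comp)
  also have "\<dots> \<subseteq> (\<phi> ^^ n) ` carrier G"
    using hom_funpow[OF assms(1)] by (intro image_mono) (auto simp: hom_def)
  finally show ?thesis
    using assms(2,3) by (auto simp: SH_exponent_def intro: inj_on_subset)
qed

lemma (in group) SH_exponent_iff_kernels: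
  assumes "\<phi> \<in> hom G G"
  shows "SH_exponent G \<phi> n \<longleftrightarrow>
    n > 0 \<and> (\<forall>x \<in> carrier G. (\<phi> ^^ Suc n) x = \<one> \<longrightarrow> (\<phi> ^^ n) x = \<one>)"
proof -
  interpret \<phi>: group_hom G G "\<phi> ^^ n" 
    using hom_funpow[OF assms] by unfold_locales
  interpret f: group_hom G G \<phi> 
    using assms by unfold_locales
  have "inj_on \<phi> ((\<phi> ^^ n) ` carrier G) \<longleftrightarrow>
      (\<forall>x \<in> carrier G. (\<phi> ^^ Suc n) x = \<one> \<longrightarrow> (\<phi> ^^ n) x = \<one>)" (is "?L \<longleftrightarrow> ?R")
  proof
    assume L: ?L
    show ?R
    proof (intro ballI impI)
      fix x assume x: "x \<in> carrier G" "(\<phi> ^^ Suc n) x = \<one>"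
      have "\<phi> ((\<phi> ^^ n) x) = \<phi> ((\<phi> ^^ n) \<one>)" using x by simp
      then have "(\<phi> ^^ n) x = (\<phi> ^^ n) \<one>" using inj_onD[OF L] x(1) one_closed by blast
      then show "(\<phi> ^^ n) x = \<one>" by simp
    qed
  next
    assume R: ?R
    show ?L
    proof (rule inj_onI, clarify)
      fix x y assume xy: "x \<in> carrier G" "y \<in> carrier G" "\<phi> ((\<phi> ^^ n) x) = \<phi> ((\<phi> ^^ n) y)"
      then have "(\<phi> ^^ Suc n) (x \<otimes> inv y) = \<one>"
        by simp
      with R xy have "(\<phi> ^^ n) (x \<otimes> inv y) = \<one>" by blast
      then show "(\<phi> ^^ n) x = (\<phi> ^^ n) y"
        using xy by (simp, metis \<phi>.hom_closed inv_closed inv_equality inv_inv)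
    qed
  qed
  then show ?thesis by (simp add: SH_exponent_def)
qed

text \<open>
  The order \<open>N\<close> of the group is a uniform exponent: were an endomorphism \<open>\<phi>\<close> not injective on its \<open>N\<close>-th
  image, then it would not be injective on any earlier image, and the first \<open>N\<close> steps would each lower
  the size of the image.
\<close>

lemma finite_group_uniformly_strongly_Hopfian:
  assumes "group G" "finite (carrier G)"
  shows "uniformly_strongly_Hopfian G"
  unfolding uniformly_strongly_Hopfian_def
proof (intro exI ballI)
  fix \<phi> assume \<phi>: "\<phi> \<in> hom G G"
  let ?N = "card (carrier G)"
  let ?I = "\<lambda>i. (\<phi> ^^ i) ` carrier G"
  have ne: "carrier G \<noteq> {}" using assms(1) by (auto simp: group.is_monoid monoid.carrier_not_empty)
  have "?N > 0" using assms(2) ne by (simp add: card_gt_0_iff)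
  show "SH_exponent G \<phi> ?N"
  proof (rule ccontr)
    assume "\<not> SH_exponent G \<phi> ?N"
    then have ninj: "\<not> inj_on \<phi> (?I ?N)" using \<open>?N > 0\<close> by (simp add: SH_exponent_def)
    have "card (?I i) + i \<le> ?N" if "i \<le> ?N" for i
      using that
    proof (induction i)
      case (Suc i)
      have "\<phi> ^^ ?N = (\<phi> ^^ i) \<circ> (\<phi> ^^ (?N - i))"
        using Suc.prems by (simp flip: funpow_add)
      then have "?I ?N = (\<phi> ^^ i) ` ?I (?N - i)"
        by (simp only: image_comp)
      also have "\<dots> \<subseteq> ?I i"
        using hom_funpow[OF \<phi>] by (intro image_mono) (auto simp: hom_def)
      finally have "\<not> inj_on \<phi> (?I i)"
        using ninj inj_on_subset by blast
      then have "card (\<phi> ` ?I i) \<noteq> card (?I i)"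
        using assms(2) eq_card_imp_inj_on by blast
      moreover have "card (\<phi> ` ?I i) \<le> card (?I i)"
        using assms(2) by (intro card_image_le) simp
      moreover have "?I (Suc i) = \<phi> ` ?I i" by (auto simp: image_image)
      ultimately show ?case using Suc by simp
    qed simp
    from this[of ?N] have "card (?I ?N) = 0" by simp
    with assms(2) ne show False by simp
  qed
qed

section \<open>Bounded strongly Hopfian primary groups\<close>

theorem (in comm_group) bounded_strongly_Hopfian_imp_finite:
  assumes p: "Factorial_Ring.prime (p :: nat)"
    and bounded: "\<And>x. x \<in> carrier G \<Longrightarrow> x [^] (p ^ k) = \<one>"
    and SH: "strongly_Hopfian G"
  shows "finite (carrier G)"
proof (rule ccontr)
  assume inf: "infinite (carrier G)"
  have p0: "p > 0" using p by (simp add: prime_gt_0_nat)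
  define A where "A j = (\<lambda>x. x [^] (p ^ j)) ` carrier G" for j
  define j where "j = (LEAST i. finite (A i)) - 1"
  have "A k \<subseteq> {\<one>}" using bounded by (auto simp: A_def)
  then have "finite (A k)" by (rule finite_subset) simp
  then have fin: "finite (A (LEAST i. finite (A i)))" by (rule LeastI)
  have "A 0 = carrier G" by (force simp: A_def)
  with inf fin have l0: "(LEAST i. finite (A i)) \<noteq> 0" by metis
  with fin have finA: "finite (A (Suc j))" by (simp add: j_def)
  have infA: "infinite (A j)"
    using l0 not_less_Least[of j "\<lambda>i. finite (A i)"] by (simp add: j_def)
  have pow_Suc: "(x [^] (p ^ j)) [^] p = x [^] (p ^ Suc j)" if "x \<in> carrier G" for x
    using that by (simp add: nat_pow_pow mult.commute)
  have "(\<lambda>y. y [^] p) ` A j \<subseteq> A (Suc j)"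
    using pow_Suc by (auto simp: A_def)
  with finA have "finite ((\<lambda>y. y [^] p) ` A j)" by (rule finite_subset[rotated])
  from pigeonhole_infinite[OF infA this] obtain y0 
    where y0: "y0 \<in> A j" and inf_fibre: "infinite {y \<in> A j. y [^] p = y0 [^] p}" by blast
  obtain x0 where x0: "x0 \<in> carrier G" "y0 = x0 [^] (p ^ j)" using y0 by (auto simp: A_def)
  \<comment> \<open>The fibre through \<open>y0\<close>, translated to \<open>\<one>\<close>, gives infinitely many \<open>p ^ j\<close>-th powers of order
    dividing \<open>p\<close>.\<close>
  have pick: "\<exists>a. a \<in> carrier G \<and> a [^] (p ^ Suc j) = \<one> \<and> a [^] (p ^ j) \<notin> S" if "finite S" for S
  proof (rule ccontr)
    assume neg: "\<not> ?thesis"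
    have "(\<lambda>y. y \<otimes> inv y0) ` {y \<in> A j. y [^] p = y0 [^] p} \<subseteq> S"
    proof clarify
      fix y assume y: "y \<in> A j" "y [^] p = y0 [^] p"
      then obtain x where x: "x \<in> carrier G" "y = x [^] (p ^ j)" by (auto simp: A_def)
      have eq: "(x \<otimes> inv x0) [^] (p ^ j) = y \<otimes> inv y0"
        using x x0 by (simp add: nat_pow_distrib nat_pow_inv)
      have "(x \<otimes> inv x0) [^] (p ^ Suc j) = (y \<otimes> inv y0) [^] p"
        using pow_Suc[of "x \<otimes> inv x0"] x x0 eq by simp
      also have "\<dots> = y [^] p \<otimes> inv (y0 [^] p)"
        using x x0 by (simp add: nat_pow_distrib nat_pow_inv)
      also have "\<dots> = \<one>" using y x0 by simp
      finally show "y \<otimes> inv y0 \<in> S" using neg eq x x0 by (metis m_closed inv_closed)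
    qed
    then have "finite ((\<lambda>y. y \<otimes> inv y0) ` {y \<in> A j. y [^] p = y0 [^] p})"
      using that finite_subset by blast
    moreover have "inj_on (\<lambda>y. y \<otimes> inv y0) {y \<in> A j. y [^] p = y0 [^] p}"
      using x0 by (auto simp: inj_on_def A_def)
    ultimately show False using inf_fibre finite_imageD by blast
  qed
  have subA: "subgroup (A (Suc j)) G"
  proof -
    have "group_hom G G (\<lambda>x. x [^] (p ^ Suc j))"
      by unfold_locales (auto simp: hom_def nat_pow_distrib)
    then show ?thesis unfolding A_def by (rule group_hom.img_is_subgroup)
  qed
  \<comment> \<open>A stage of the construction: a finite graph \<open>\<Gamma>\<close> and the last element \<open>a\<close> chosen, which is to become
    the next value and therefore must be independent of the range of \<open>\<Gamma>\<close>.\<close>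
  define Inv where "Inv = (\<lambda>(\<Gamma>, a). hom_graph G \<Gamma> \<and> finite \<Gamma> \<and> A (Suc j) \<times> {\<one>} \<subseteq> \<Gamma> \<and>
    (\<forall>y \<in> snd ` \<Gamma>. y [^] (p ^ j) = \<one> \<longrightarrow> (\<exists>z \<in> snd ` \<Gamma>. y = z [^] p)) \<and>
    a \<in> carrier G \<and> a [^] (p ^ Suc j) = \<one> \<and> a [^] (p ^ j) \<notin> snd ` \<Gamma>)"
  interpret GG: comm_group "G \<times>\<times> G"
    by (intro DirProd_comm_group comm_group_axioms)
  have start: "\<exists>\<Gamma> a. Inv (\<Gamma>, a) \<and> (a, \<one>) \<in> \<Gamma>"
  proof -
    obtain a where a: "a \<in> carrier G" "a [^] (p ^ Suc j) = \<one>" "a [^] (p ^ j) \<notin> {\<one>}"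
      using pick[of "{\<one>}"] by blast
    define S where "S = adjoin G (A (Suc j)) a"
    have S: "subgroup S G" "A (Suc j) \<subseteq> S" "a \<in> S" "finite S"
      unfolding S_def using subA a finA p0
      by (auto intro: subgroup_adjoin adjoin_superset[THEN subsetD] adjoin_self finite_adjoin[of _ _ "p ^ Suc j"])
    have "subgroup (S \<times> {\<one>}) (G \<times>\<times> G)"
      using DirProd_subgroups[OF is_group S(1) is_group triv_subgroup] .
    with S have "hom_graph G (S \<times> {\<one>})" by (auto simp: hom_graph_def)
    moreover have "snd ` (S \<times> {\<one>}) = {\<one>}" using S(3) by force
    ultimately have "Inv (S \<times> {\<one>}, a)"
      using S a by (auto simp: Inv_def)
    moreover have "(a, \<one>) \<in> S \<times> {\<one>}" using S by simp
    ultimately show ?thesis by blast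
  qed
  have step: "\<exists>\<Gamma>' a'. Inv (\<Gamma>', a') \<and> \<Gamma> \<subseteq> \<Gamma>' \<and> (a', a) \<in> \<Gamma>'" if "Inv (\<Gamma>, a)" for \<Gamma> a
  proof -
    have graph: "hom_graph G \<Gamma>" and finG: "finite \<Gamma>" and sup: "A (Suc j) \<times> {\<one>} \<subseteq> \<Gamma>"
      and div: "\<And>y. y \<in> snd ` \<Gamma> \<Longrightarrow> y [^] (p ^ j) = \<one> \<Longrightarrow> \<exists>z \<in> snd ` \<Gamma>. y = z [^] p"
      and a: "a \<in> carrier G" "a [^] (p ^ Suc j) = \<one>" "a [^] (p ^ j) \<notin> snd ` \<Gamma>"
      using that by (auto simp: Inv_def)
    note sub = graph[unfolded hom_graph_def, THEN conjunct1]
    note dom = hom_graph_subgroups(1)[OF graph]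
    note ran = hom_graph_subgroups(2)[OF graph]
    have in_carr: "x \<in> carrier G" "y \<in> carrier G" if "(x, y) \<in> \<Gamma>" for x y
      using subgroup.subset[OF sub] that by auto
    define R where "R = adjoin G (snd ` \<Gamma>) a"
    have R: "subgroup R G" "snd ` \<Gamma> \<subseteq> R" "finite R"
      unfolding R_def using ran a finG p0
      by (auto intro: subgroup_adjoin adjoin_superset[THEN subsetD] adjoin_self finite_adjoin[of _ _ "p ^ Suc j"])
    \<comment> \<open>\<open>R\<close> is the range after the next step, whichever argument \<open>a'\<close> is mapped to \<open>a\<close>. So \<open>a'\<close> can be
      taken independent of the old domain and of the new range at once.\<close>
    obtain a' where a': "a' \<in> carrier G" "a' [^] (p ^ Suc j) = \<one>" "a' [^] (p ^ j) \<notin> fst ` \<Gamma> \<union> R"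
      using pick[of "fst ` \<Gamma> \<union> R"] finG R(3) by blast
    define \<Gamma>' where "\<Gamma>' = adjoin (G \<times>\<times> G) \<Gamma> (a', a)"
    have ran': "snd ` \<Gamma>' = R"
      unfolding \<Gamma>'_def R_def by (rule snd_adjoin_DirProd[OF a'(1) a(1)])
    have graph': "hom_graph G \<Gamma>'"
      unfolding \<Gamma>'_def
    proof (rule hom_graph_adjoin[OF graph a'(1) a(1)])
      fix x y and m :: int
      assume xy: "(x, y) \<in> \<Gamma>" and eq: "x \<otimes> a' [^] m = \<one>"
      note xyc = in_carr[OF xy]
      have "a' [^] m = inv x"
        using eq xyc a' by (metis int_pow_closed inv_equality m_comm inv_inv)
      also have "\<dots> \<in> fst ` \<Gamma>"
        using xy by (intro subgroup.m_inv_closed[OF dom]) force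
      finally have "int (p ^ Suc j) dvd m"
        using a' subgroup.one_closed[OF dom]
        by (intro prime_power_dvd_exponent[OF dom _ p, of a']) simp_all
      then obtain m' where m': "m = int (p ^ Suc j) * m'" by auto
      have pm: "c [^] m = \<one>" if "c \<in> carrier G" "c [^] (p ^ Suc j) = \<one>" for c
      proof -
        have "c [^] m = (c [^] int (p ^ Suc j)) [^] m'"
          using that(1) by (simp only: m' int_pow_pow)
        with that(2) show ?thesis by (simp only: int_pow_int int_pow_one)
      qed
      have "x = \<one>" using eq pm[OF a'(1,2)] xyc by simp
      with graph xy have "y = \<one>" by (simp add: hom_graph_def)
      then show "y \<otimes> a [^] m = \<one>" using pm[OF a(1,2)] by simp
    qed
    \<comment> \<open>Since \<open>a\<close> is independent of the old range, \<open>b a ^ m\<close> can only be killed by \<open>p ^ j\<close> if \<open>p\<close> divides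
      \<open>m\<close> and \<open>b\<close> is killed as well.\<close>
    have div': "\<exists>z \<in> R. y = z [^] p" if "y \<in> R" "y [^] (p ^ j) = \<one>" for y
    proof -
      obtain b and m :: int where b: "b \<in> snd ` \<Gamma>" "y = b \<otimes> a [^] m"
        using \<open>y \<in> R\<close> by (auto simp: R_def adjoin_def)
      have bc: "b \<in> carrier G" using b subgroup.subset[OF ran] by blast
      define c where "c = a [^] (p ^ j)"
      have cc: "c \<in> carrier G" using a by (simp add: c_def)
      have apj: "(a [^] m) [^] (p ^ j) = c [^] m"
        using a(1) by (simp add: c_def int_pow_pow mult.commute flip: int_pow_int)
      have eq: "b [^] (p ^ j) \<otimes> c [^] m = \<one>"
        using that(2) bc a by (simp add: b(2) nat_pow_distrib apj)
      then have "c [^] m = inv (b [^] (p ^ j))"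
        using bc cc by (metis int_pow_closed nat_pow_closed inv_equality m_comm inv_inv)
      also have "\<dots> = inv (b [^] int (p ^ j))" by (simp only: int_pow_int)
      also have "\<dots> \<in> snd ` \<Gamma>"
        by (intro subgroup.m_inv_closed[OF ran] subgroup_int_pow_closed[OF ran] b)
      finally have "c [^] m \<in> snd ` \<Gamma>" .
      moreover have cp: "c [^] p = \<one>" using pow_Suc[OF a(1)] a(2) by (simp add: c_def)
      ultimately have "int (p ^ Suc 0) dvd m"
        using a cc subgroup.one_closed[OF ran]
        by (intro prime_power_dvd_exponent[OF ran cc p]) (simp_all add: c_def)
      then obtain m' where m': "m = int p * m'" by auto
      have "c [^] m = (c [^] int p) [^] m'"
        using cc by (simp only: m' int_pow_pow)
      then have "c [^] m = \<one>" using cp by (simp only: int_pow_int int_pow_one)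
      with eq have "b [^] (p ^ j) = \<one>" using bc by simp
      with b div obtain z where z: "z \<in> snd ` \<Gamma>" "b = z [^] p" by blast
      have zc: "z \<in> carrier G" using z subgroup.subset[OF ran] by blast
      have "(a [^] m') [^] p = a [^] m"
        using a(1) by (simp add: m' int_pow_pow mult.commute flip: int_pow_int)
      then have "y = (z \<otimes> a [^] m') [^] p"
        using zc a(1) b(2) z(2) by (simp add: nat_pow_distrib)
      moreover have "z \<otimes> a [^] m' \<in> R" using z(1) unfolding R_def adjoin_def by blast
      ultimately show ?thesis by blast
    qed
    have "\<Gamma> \<subseteq> \<Gamma>'" "(a', a) \<in> \<Gamma>'"
      unfolding \<Gamma>'_def using a(1) a'(1) by (intro GG.adjoin_superset GG.adjoin_self sub; simp)+
    moreover have "finite \<Gamma>'"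
    proof -
      have "(a', a) [^]\<^bsub>G \<times>\<times> G\<^esub> (p ^ Suc j) = \<one>\<^bsub>G \<times>\<times> G\<^esub>"
        using DirProd_int_pow[OF is_group is_group a'(1) a(1), of "int (p ^ Suc j)"] a(2) a'(2)
        by (simp only: int_pow_int one_DirProd)
      from GG.finite_adjoin[OF finG _ this] show ?thesis
        unfolding \<Gamma>'_def using a(1) a'(1) p0 by simp
    qed
    ultimately have "Inv (\<Gamma>', a')"
      using graph' div' subset_trans[OF sup] a' unfolding Inv_def prod.case ran' by blast
    then show ?thesis using \<open>\<Gamma> \<subseteq> \<Gamma>'\<close> \<open>(a', a) \<in> \<Gamma>'\<close> by blast
  qed
  have "\<exists>s. \<forall>n. (Inv (s n) \<and> (n = 0 \<longrightarrow> (snd (s n), \<one>) \<in> fst (s n))) \<and>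
      (fst (s n) \<subseteq> fst (s (Suc n)) \<and> (snd (s (Suc n)), snd (s n)) \<in> fst (s (Suc n)))"
  proof (rule dependent_nat_choice)
    show "\<exists>t. Inv t \<and> (0 = (0::nat) \<longrightarrow> (snd t, \<one>) \<in> fst t)"
      using start by force
    show "\<exists>t'. (Inv t' \<and> (Suc n = 0 \<longrightarrow> (snd t', \<one>) \<in> fst t')) \<and>
        fst t \<subseteq> fst t' \<and> (snd t', snd t) \<in> fst t'"
      if "Inv t \<and> (n = 0 \<longrightarrow> (snd t, \<one>) \<in> fst t)" for t n
      using step[of "fst t" "snd t"] that by auto
  qed
  then obtain s where s: "\<And>n. Inv (s n)" "(snd (s 0), \<one>) \<in> fst (s 0)"
      "\<And>n. fst (s n) \<subseteq> fst (s (Suc n))" "\<And>n. (snd (s (Suc n)), snd (s n)) \<in> fst (s (Suc n))"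
    by blast
  define \<Gamma> where "\<Gamma> n = fst (s n)" for n
  define a where "a n = snd (s n)" for n
  have I: "Inv (\<Gamma> n, a n)" for n using s(1) by (simp add: \<Gamma>_def a_def)
  have graph: "hom_graph G (\<Gamma> n)" and sup: "A (Suc j) \<times> {\<one>} \<subseteq> \<Gamma> n"
    and div: "\<And>y. y \<in> snd ` \<Gamma> n \<Longrightarrow> y [^] (p ^ j) = \<one> \<Longrightarrow> \<exists>z \<in> snd ` \<Gamma> n. y = z [^] p"
    and a: "a n \<in> carrier G" "a n [^] (p ^ j) \<notin> snd ` \<Gamma> n" for n
    using I[of n] by (auto simp: Inv_def)
  have mono: "\<Gamma> m \<subseteq> \<Gamma> n" if "m \<le> n" for m n
    by (rule lift_Suc_mono_le[OF _ that]) (use s(3) in \<open>simp add: \<Gamma>_def\<close>)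
  have "hom_graph G (\<Union>(range \<Gamma>))"
  proof (rule hom_graph_Union)
    show "X \<subseteq> Y \<or> Y \<subseteq> X" if "X \<in> range \<Gamma>" "Y \<in> range \<Gamma>" for X Y
      using that mono by (metis imageE nat_le_linear)
  qed (use graph in auto)
  then obtain f where f: "f \<in> hom G G" "\<And>x y. (x, y) \<in> \<Union>(range \<Gamma>) \<Longrightarrow> f x = y"
  proof (rule hom_graph_extends_to_endomorphism[OF p, rotated])
    show "\<exists>i. x [^] (p ^ i) = \<one>" if "x \<in> carrier G" for x using bounded that by blast
    show "(x [^] (p ^ Suc j), \<one>) \<in> \<Union>(range \<Gamma>)" if "x \<in> carrier G" for x
      using sup that by (force simp: A_def)
    show "\<exists>z\<in>snd ` \<Union>(range \<Gamma>). y = z [^] p" if "y \<in> snd ` \<Union>(range \<Gamma>)" "y [^] (p ^ j) = \<one>" for y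
    proof -
      obtain n where "y \<in> snd ` \<Gamma> n" using \<open>y \<in> snd ` \<Union>(range \<Gamma>)\<close> by auto
      from div[OF this that(2)] show ?thesis by blast
    qed
  qed blast
  have fa: "f (a (Suc n)) = a n" for n
    using s(4)[of n] by (intro f(2)) (auto simp: \<Gamma>_def a_def)
  have fa0: "f (a 0) = \<one>"
    using s(2) by (intro f(2)) (auto simp: \<Gamma>_def a_def)
  \<comment> \<open>\<open>f ^^ n\<close> maps \<open>a n\<close> to \<open>a 0 \<noteq> \<one>\<close>, which \<open>f\<close> maps to \<open>\<one>\<close>.\<close>
  obtain n where "SH_exponent G f n" using SH f(1) by (auto simp: strongly_Hopfian_def)
  then have kernels: "(f ^^ Suc n) x = \<one> \<longrightarrow> (f ^^ n) x = \<one>" if "x \<in> carrier G" for x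
    using that SH_exponent_iff_kernels[OF f(1)] by blast
  have "(f ^^ n) (a n) = a 0"
    by (induction n) (simp_all add: fa funpow_swap1)
  then have "a 0 = \<one>" using kernels[OF a(1)[of n]] fa0 by simp
  moreover have "\<one> \<in> snd ` \<Gamma> 0"
    using subgroup.one_closed[OF hom_graph_subgroups(2)[OF graph]] .
  ultimately show False using a(2)[of 0] by simp
qed

section \<open>Torsion subgroups\<close>

context group
begin

lemma pow_mult_eq_one:
  assumes "x \<in> carrier G" "x [^] m = \<one>"
  shows "x [^] (m * n :: nat) = \<one>"
  using assms by (metis nat_pow_pow nat_pow_one)

lemma coprime_pows_eq_one:
  assumes "x \<in> carrier G" "x [^] m = \<one>" "x [^] n = \<one>" "coprime m (n :: nat)"
  shows "x = \<one>"
proof -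
  obtain u v where "u * int m + v * int n = 1"
    using bezout_int[of "int m" "int n"] assms(4) by auto
  then have "x = x [^] (int m * u + int n * v)" using assms(1) by (simp add: mult.commute)
  also have "\<dots> = (x [^] int m) [^] u \<otimes> (x [^] int n) [^] v"
    using assms(1) by (simp only: int_pow_mult int_pow_pow)
  also have "\<dots> = \<one>" using assms(2,3) by (simp only: int_pow_int) simp
  finally show ?thesis .
qed

lemma endomorphism_pow:
  assumes "subgroup S G" "f \<in> hom (G\<lparr>carrier := S\<rparr>) (G\<lparr>carrier := S\<rparr>)" "x \<in> S"
  shows "f x \<in> S" "f (x [^] (n::nat)) = f x [^] n"
proof -
  have "group (G\<lparr>carrier := S\<rparr>)" using subgroup_imp_group[OF assms(1)] .
  from hom_nat_pow[OF assms(2) _ this this, of x n] assms(3)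
  show "f (x [^] n) = f x [^] n" by (simp flip: nat_pow_consistent)
  show "f x \<in> S" using assms(2,3) by (auto simp: hom_def)
qed

lemma endomorphism_one:
  assumes "subgroup S G" "f \<in> hom (G\<lparr>carrier := S\<rparr>) (G\<lparr>carrier := S\<rparr>)"
  shows "f \<one> = \<one>"
  using endomorphism_pow(2)[OF assms subgroup.one_closed[OF assms(1)], of 0] by simp

lemma endomorphism_pow_one:
  assumes "subgroup S G" "f \<in> hom (G\<lparr>carrier := S\<rparr>) (G\<lparr>carrier := S\<rparr>)" "x \<in> S"
    "x [^] (n::nat) = \<one>"
  shows "f x [^] n = \<one>"
  using endomorphism_pow(2)[OF assms(1-3), of n] endomorphism_one[OF assms(1,2)] assms(4) by simp

end

text \<open>The underlying sets of the torsion subgroup and of the \<open>p\<close>-torsion subgroup.\<close>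

abbreviation tors :: "('a, 'b) monoid_scheme \<Rightarrow> 'a set"
  where "tors G \<equiv> carrier (torsion_group G)"

abbreviation ptors :: "('a, 'b) monoid_scheme \<Rightarrow> nat \<Rightarrow> 'a set"
  where "ptors G p \<equiv> carrier (p_torsion_group G p)"

lemma tors_iff: "x \<in> tors G \<longleftrightarrow> x \<in> carrier G \<and> (\<exists>n>0. x [^]\<^bsub>G\<^esub> (n::nat) = \<one>\<^bsub>G\<^esub>)"
  by (simp add: torsion_group_def)

lemma ptors_iff: "x \<in> ptors G p \<longleftrightarrow> x \<in> carrier G \<and> (\<exists>k. x [^]\<^bsub>G\<^esub> (p ^ k) = \<one>\<^bsub>G\<^esub>)"
  by (simp add: p_torsion_group_def)

lemma torsion_group_eq: "torsion_group G = G\<lparr>carrier := tors G\<rparr>"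
  by (simp add: torsion_group_def)

lemma p_torsion_group_eq: "p_torsion_group G p = G\<lparr>carrier := ptors G p\<rparr>"
  by (simp add: p_torsion_group_def)

context comm_group
begin

lemma subgroup_tors: "subgroup (tors G) G"
proof (rule subgroupI)
  have "\<one> \<in> tors G" by (auto simp: tors_iff)
  then show "tors G \<noteq> {}" by blast
  show "inv x \<in> tors G" if "x \<in> tors G" for x
    using that by (auto simp: tors_iff nat_pow_inv)
  show "x \<otimes> y \<in> tors G" if x: "x \<in> tors G" and y: "y \<in> tors G" for x y
  proof -
    obtain m n :: nat where mn: "m > 0" "x [^] m = \<one>" "n > 0" "y [^] n = \<one>"
      using x y by (auto simp: tors_iff)
    have "x [^] (m * n) = \<one>" "y [^] (m * n) = \<one>"
      using x y mn pow_mult_eq_one[of x m n] pow_mult_eq_one[of y n m]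
      by (simp_all add: tors_iff mult.commute)
    then have "(x \<otimes> y) [^] (m * n) = \<one>" using x y by (simp add: nat_pow_distrib tors_iff)
    with x y mn show ?thesis by (auto simp: tors_iff intro!: exI[of _ "m * n"])
  qed
qed (auto simp: tors_iff)

lemma subgroup_ptors: "subgroup (ptors G p) G"
proof (rule subgroupI)
  have "\<one> \<in> ptors G p" by (auto simp: ptors_iff)
  then show "ptors G p \<noteq> {}" by blast
  show "inv x \<in> ptors G p" if "x \<in> ptors G p" for x
    using that by (auto simp: ptors_iff nat_pow_inv)
  show "x \<otimes> y \<in> ptors G p" if x: "x \<in> ptors G p" and y: "y \<in> ptors G p" for x y
  proof -
    obtain m n :: nat where mn: "x [^] (p ^ m) = \<one>" "y [^] (p ^ n) = \<one>"
      using x y by (auto simp: ptors_iff)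
    have "x [^] (p ^ (m + n)) = \<one>" "y [^] (p ^ (m + n)) = \<one>"
      using x y mn pow_mult_eq_one[of x "p ^ m" "p ^ n"] pow_mult_eq_one[of y "p ^ n" "p ^ m"]
      by (simp_all add: ptors_iff power_add mult.commute)
    then have "(x \<otimes> y) [^] (p ^ (m + n)) = \<one>" using x y by (simp add: nat_pow_distrib ptors_iff)
    with x y show ?thesis by (auto simp: ptors_iff intro!: exI[of _ "m + n"])
  qed
qed (auto simp: ptors_iff)

lemma ptors_subset_tors:
  assumes "Factorial_Ring.prime p"
  shows "ptors G p \<subseteq> tors G"
proof
  fix x assume "x \<in> ptors G p"
  then obtain k where "x \<in> carrier G" "x [^] (p ^ k) = \<one>" by (auto simp: ptors_iff)
  moreover have "p ^ k > 0" using assms by (simp add: prime_gt_0_nat)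
  ultimately show "x \<in> tors G" unfolding tors_iff by blast
qed

lemma endomorphism_ptors:
  assumes "subgroup S G" "f \<in> hom (G\<lparr>carrier := S\<rparr>) (G\<lparr>carrier := S\<rparr>)" "x \<in> S" "x \<in> ptors G p"
  shows "f x \<in> ptors G p"
proof -
  obtain k where "x [^] (p ^ k) = \<one>" using assms(4) by (auto simp: ptors_iff)
  from endomorphism_pow_one[OF assms(1-3) this] have "f x [^] (p ^ k) = \<one>" .
  moreover have "f x \<in> carrier G"
    using endomorphism_pow(1)[OF assms(1-3)] subgroup.mem_carrier[OF assms(1)] by blast
  ultimately show ?thesis unfolding ptors_iff by blast
qed

lemma endomorphism_restrict_ptors:
  assumes "subgroup S G" "f \<in> hom (G\<lparr>carrier := S\<rparr>) (G\<lparr>carrier := S\<rparr>)" "ptors G p \<subseteq> S"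
  shows "f \<in> hom (p_torsion_group G p) (p_torsion_group G p)"
proof -
  have "f \<in> hom (G\<lparr>carrier := ptors G p\<rparr>) (G\<lparr>carrier := ptors G p\<rparr>)"
    using assms(2) subsetD[OF assms(3)] endomorphism_ptors[OF assms(1,2)] by (auto simp: hom_def)
  then show ?thesis by (simp flip: p_torsion_group_eq)
qed

lemma group_p_torsion_group: "group (p_torsion_group G p)"
  using subgroup_imp_group[OF subgroup_ptors, of p] by (simp flip: p_torsion_group_eq)

end

section \<open>Groups with projections onto their primary parts\<close>

text \<open>
  An abelian group \<open>G\<close> with retractions \<open>\<pi> p\<close> onto its \<open>p\<close>-torsion subgroups that together embed \<open>G\<close> into
  the product of these subgroups, and with divisible quotient of \<open>G\<close> by its torsion subgroup. The
  values of \<open>\<pi>\<close> at indices that are not prime are irrelevant.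
\<close>

locale primary_projections = comm_group +
  fixes \<pi> :: "nat \<Rightarrow> 'a \<Rightarrow> 'a"
  assumes proj_hom: "Factorial_Ring.prime p \<Longrightarrow> \<pi> p \<in> hom G G"
    and proj_ptors: "Factorial_Ring.prime p \<Longrightarrow> x \<in> carrier G \<Longrightarrow> \<pi> p x \<in> ptors G p"
    and proj_id: "Factorial_Ring.prime p \<Longrightarrow> x \<in> ptors G p \<Longrightarrow> \<pi> p x = x"
    and proj_separate: "x \<in> carrier G \<Longrightarrow> (\<And>p. Factorial_Ring.prime p \<Longrightarrow> \<pi> p x = \<one>) \<Longrightarrow> x = \<one>"
    and divisible_mod_tors: "x \<in> carrier G \<Longrightarrow> n > 0 \<Longrightarrow>
      \<exists>y \<in> carrier G. \<exists>t \<in> tors G. x = y [^] (n::nat) \<otimes> t"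
begin

lemma proj_closed:
  assumes "Factorial_Ring.prime p" "x \<in> carrier G"
  shows "\<pi> p x \<in> carrier G"
  using proj_ptors[OF assms] by (simp add: ptors_iff)

lemma proj_pow:
  assumes "Factorial_Ring.prime p" "x \<in> carrier G"
  shows "\<pi> p (x [^] (n::nat)) = \<pi> p x [^] n"
  using hom_nat_pow[OF proj_hom[OF assms(1)] assms(2) is_group is_group] .

lemma proj_mult:
  assumes "Factorial_Ring.prime p" "x \<in> carrier G" "y \<in> carrier G"
  shows "\<pi> p (x \<otimes> y) = \<pi> p x \<otimes> \<pi> p y"
  using hom_mult[OF proj_hom[OF assms(1)] assms(2,3)] .

lemma proj_one:
  assumes "Factorial_Ring.prime p"
  shows "\<pi> p \<one> = \<one>"
  using hom_one[OF proj_hom[OF assms] is_group is_group] .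

lemma proj_ext:
  assumes x: "x \<in> carrier G" and y: "y \<in> carrier G"
    and eq: "\<And>p. Factorial_Ring.prime p \<Longrightarrow> \<pi> p x = \<pi> p y"
  shows "x = y"
proof -
  have "\<pi> p (x \<otimes> inv y) = \<one>" if p: "Factorial_Ring.prime p" for p
  proof -
    have "\<pi> p (x \<otimes> inv y) = \<pi> p (y \<otimes> inv y)"
      using eq[OF p] x y p by (simp add: proj_mult del: r_inv Units_r_inv)
    then show ?thesis using y p by (simp add: proj_one)
  qed
  moreover have "x \<otimes> inv y \<in> carrier G" using x y by simp
  ultimately have "x \<otimes> inv y = \<one>" using proj_separate by blast
  then show ?thesis using x y by (metis inv_closed inv_equality inv_inv)
qed

lemma proj_coprime_order:
  assumes p: "Factorial_Ring.prime p" and x: "x \<in> carrier G" "x [^] (m::nat) = \<one>" "coprime p m"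
  shows "\<pi> p x = \<one>"
proof -
  obtain k where k: "\<pi> p x [^] (p ^ k) = \<one>"
    using proj_ptors[OF p x(1)] by (auto simp: ptors_iff)
  have "\<pi> p x [^] m = \<one>" using proj_pow[OF p x(1), of m] x p by (simp add: proj_one)
  moreover have "coprime (p ^ k) m" using x(3) by simp
  ultimately show ?thesis by (rule coprime_pows_eq_one[OF proj_closed[OF p x(1)] k])
qed

lemma proj_other_prime:
  assumes "Factorial_Ring.prime p" "Factorial_Ring.prime q" "p \<noteq> q" "x \<in> ptors G q"
  shows "\<pi> p x = \<one>"
proof -
  obtain k where "x \<in> carrier G" "x [^] (q ^ k) = \<one>" using assms(4) by (auto simp: ptors_iff)
  moreover have "coprime p (q ^ k)" using assms by (simp add: primes_coprime)
  ultimately show ?thesis using assms(1) by (intro proj_coprime_order)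
qed

text \<open>The converse of \<open>proj_coprime_order\<close> for torsion elements.\<close>

lemma tors_kernel_proj:
  assumes p: "Factorial_Ring.prime p" and x: "x \<in> tors G" "\<pi> p x = \<one>"
  obtains m where "coprime p m" "x [^] (m::nat) = \<one>"
proof -
  obtain n :: nat where n: "x \<in> carrier G" "n > 0" "x [^] n = \<one>" using x by (auto simp: tors_iff)
  obtain m where m: "n = p ^ multiplicity p n * m" "\<not> p dvd m"
    using n(2) p by (metis multiplicity_decompose' not_prime_unit not_less0)
  have "(x [^] m) [^] (p ^ multiplicity p n) = \<one>"
    using n m(1) by (metis nat_pow_pow mult.commute)
  then have "x [^] m \<in> ptors G p" using n by (auto simp: ptors_iff)
  then have "x [^] m = \<pi> p x [^] m" using p proj_id proj_pow n by metis
  with x have "x [^] m = \<one>" by simp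
  moreover have "coprime p m" using m p by (simp add: prime_imp_coprime)
  ultimately show ?thesis using that by blast
qed

text \<open>
  Every endomorphism of a subgroup \<open>S\<close> containing the torsion subgroup commutes with the projections
  on torsion elements: \<open>x\<close> and \<open>\<pi> p x\<close> differ by an element of order prime to \<open>p\<close>, and so do their
  images.
\<close>

lemma endomorphism_proj_tors:
  assumes S: "subgroup S G" "tors G \<subseteq> S" and f: "f \<in> hom (G\<lparr>carrier := S\<rparr>) (G\<lparr>carrier := S\<rparr>)"
    and p: "Factorial_Ring.prime p" and x: "x \<in> tors G"
  shows "\<pi> p (f x) = f (\<pi> p x)"
proof -
  have xc: "x \<in> carrier G" using x by (simp add: tors_iff)
  have px: "\<pi> p x \<in> ptors G p" using proj_ptors[OF p xc] .
  then have pxT: "\<pi> p x \<in> tors G" using ptors_subset_tors[OF p] by blast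
  have pxc: "\<pi> p x \<in> carrier G" using proj_closed[OF p xc] .
  define y where "y = x \<otimes> inv (\<pi> p x)"
  have y: "y \<in> tors G" unfolding y_def
    using x pxT by (intro subgroup.m_closed[OF subgroup_tors] subgroup.m_inv_closed[OF subgroup_tors])
  have yc: "y \<in> carrier G" using y by (simp add: tors_iff)
  have xy: "x = y \<otimes> \<pi> p x" using xc pxc by (simp add: y_def m_assoc)
  have "\<pi> p x = \<pi> p y \<otimes> \<pi> p x"
    using proj_mult[OF p yc pxc] proj_id[OF p px] xy by simp
  then have "\<pi> p y = \<one>" using proj_closed[OF p yc] pxc by (metis r_cancel_one')
  then obtain m where m: "coprime p m" "y [^] (m::nat) = \<one>" using tors_kernel_proj[OF p y] by blast
  have yS: "y \<in> S" and pxS: "\<pi> p x \<in> S" using y pxT S by auto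
  have fc: "f y \<in> carrier G" "f (\<pi> p x) \<in> carrier G"
    using endomorphism_pow(1)[OF S(1) f] yS pxS S subgroup.mem_carrier by metis+
  have "\<pi> p (f y) = \<one>"
    using m fc endomorphism_pow_one[OF S(1) f yS m(2)] by (intro proj_coprime_order[OF p])
  moreover have "f (y \<otimes> \<pi> p x) = f y \<otimes> f (\<pi> p x)"
    using f yS pxS by (auto simp: hom_def)
  then have "f x = f y \<otimes> f (\<pi> p x)" by (simp flip: xy)
  moreover have "\<pi> p (f (\<pi> p x)) = f (\<pi> p x)"
    using endomorphism_ptors[OF S(1) f pxS px] by (intro proj_id[OF p])
  ultimately show ?thesis using fc by (simp add: proj_mult[OF p])
qed

text \<open>
  Commutation extends from torsion elements to all of \<open>G\<close> if \<open>p ^ k\<close> annihilates the \<open>p\<close>-torsion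
  subgroup: then \<open>\<pi> p\<close> is trivial on \<open>p ^ k\<close>-th powers, and every element of \<open>G\<close> is a torsion element
  up to a \<open>p ^ k\<close>-th power.
\<close>

lemma endomorphism_proj:
  assumes f: "f \<in> hom G G" and p: "Factorial_Ring.prime p" and x: "x \<in> carrier G"
    and bounded: "\<And>x. x \<in> ptors G p \<Longrightarrow> x [^] (p ^ k) = \<one>"
  shows "\<pi> p (f x) = f (\<pi> p x)"
proof -
  have f': "f \<in> hom (G\<lparr>carrier := carrier G\<rparr>) (G\<lparr>carrier := carrier G\<rparr>)" using f by simp
  have fc: "f z \<in> carrier G" if "z \<in> carrier G" for z using f that by (rule hom_in_carrier)
  obtain y t where yt: "y \<in> carrier G" "t \<in> tors G" "x = y [^] (p ^ k) \<otimes> t"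
    using divisible_mod_tors[OF x, of "p ^ k"] p by (auto simp: prime_gt_0_nat)
  have tc: "t \<in> carrier G" using yt by (simp add: tors_iff)
  have kill: "\<pi> p (z [^] (p ^ k)) = \<one>" if "z \<in> carrier G" for z
    using bounded[OF proj_ptors[OF p that]] proj_pow[OF p that] by simp
  have "\<pi> p x = \<pi> p t"
    using yt tc kill by (simp add: proj_mult[OF p] proj_closed[OF p])
  moreover have "f x = f y [^] (p ^ k) \<otimes> f t"
    using yt tc f by (simp add: hom_mult[OF f] hom_nat_pow[OF f] is_group)
  then have "\<pi> p (f x) = \<pi> p (f t)"
    using yt tc kill fc by (simp add: proj_mult[OF p] proj_closed[OF p])
  moreover have "\<pi> p (f t) = f (\<pi> p t)"
    by (rule endomorphism_proj_tors[OF subgroup_self _ f' p yt(2)]) (auto simp: tors_iff)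
  ultimately show ?thesis by simp
qed

text \<open>Passage from the primary parts to \<open>S\<close>, which is used both for \<open>G\<close> and for its torsion subgroup.\<close>

lemma SH_exponent_of_primary:
  assumes S: "subgroup S G" "tors G \<subseteq> S" and f: "f \<in> hom (G\<lparr>carrier := S\<rparr>) (G\<lparr>carrier := S\<rparr>)"
    and commute: "\<And>p x. Factorial_Ring.prime p \<Longrightarrow> x \<in> S \<Longrightarrow> \<pi> p (f x) = f (\<pi> p x)"
    and exponent: "\<And>p g. Factorial_Ring.prime p \<Longrightarrow>
      g \<in> hom (p_torsion_group G p) (p_torsion_group G p) \<Longrightarrow> SH_exponent (p_torsion_group G p) g n"
  shows "SH_exponent (G\<lparr>carrier := S\<rparr>) f n"
proof -
  interpret S: group "G\<lparr>carrier := S\<rparr>" using subgroup_imp_group[OF S(1)] .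
  have sub: "ptors G p \<subseteq> S" if "Factorial_Ring.prime p" for p :: nat
    using ptors_subset_tors[OF that] S(2) by blast
  have Sc: "x \<in> carrier G" if "x \<in> S" for x using that subgroup.mem_carrier[OF S(1)] by blast
  have fS: "(f ^^ i) x \<in> S" if "x \<in> S" for i x
    using hom_funpow[OF f, of i] that by (auto simp: hom_def)
  have com: "\<pi> p ((f ^^ i) x) = (f ^^ i) (\<pi> p x)" if "Factorial_Ring.prime p" "x \<in> S" for p i x
    using that by (induction i) (simp_all add: commute fS)
  have ker: "n > 0 \<and> (\<forall>x\<in>ptors G p. (f ^^ Suc n) x = \<one> \<longrightarrow> (f ^^ n) x = \<one>)"
    if p: "Factorial_Ring.prime p" for p
  proof -
    note g = group_p_torsion_group[of p]
    have h: "f \<in> hom (p_torsion_group G p) (p_torsion_group G p)"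
      using endomorphism_restrict_ptors[OF S(1) f sub[OF p]] .
    show ?thesis
      using exponent[OF p h] unfolding group.SH_exponent_iff_kernels[OF g h]
      by (simp add: p_torsion_group_def)
  qed
  have "(f ^^ n) x = \<one>" if x: "x \<in> S" and fx: "(f ^^ Suc n) x = \<one>" for x
  proof (rule proj_separate)
    fix p :: nat assume p: "Factorial_Ring.prime p"
    have "(f ^^ Suc n) (\<pi> p x) = \<one>" using com[OF p x, of "Suc n"] fx p by (simp add: proj_one)
    with ker[OF p] proj_ptors[OF p Sc[OF x]] have "(f ^^ n) (\<pi> p x) = \<one>" by blast
    then show "\<pi> p ((f ^^ n) x) = \<one>" using com[OF p x] by simp
  qed (use fS x Sc in blast)
  moreover have "n > 0" using ker[of 2] by simp
  ultimately show ?thesis unfolding S.SH_exponent_iff_kernels[OF f] by simp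
qed

lemma comp_proj_hom:
  assumes S: "subgroup S G" "tors G \<subseteq> S" and p: "Factorial_Ring.prime p"
    and g: "g \<in> hom (p_torsion_group G p) (p_torsion_group G p)"
  shows "g \<circ> \<pi> p \<in> hom (G\<lparr>carrier := S\<rparr>) (G\<lparr>carrier := S\<rparr>)"
proof -
  have Sc: "x \<in> carrier G" if "x \<in> S" for x using that subgroup.mem_carrier[OF S(1)] by blast
  have "g (\<pi> p x) \<in> S" if "x \<in> S" for x
    using hom_in_carrier[OF g proj_ptors[OF p Sc[OF that]]] ptors_subset_tors[OF p] S(2) by blast
  moreover have "g (\<pi> p (x \<otimes> y)) = g (\<pi> p x) \<otimes> g (\<pi> p y)" if "x \<in> S" "y \<in> S" for x y
    using hom_mult[OF g proj_ptors[OF p Sc[OF that(1)]] proj_ptors[OF p Sc[OF that(2)]]]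
      proj_mult[OF p Sc[OF that(1)] Sc[OF that(2)]] by (simp add: p_torsion_group_def)
  ultimately show ?thesis by (auto simp: hom_def)
qed

text \<open>
  Passage from \<open>S\<close> to a primary part. The endomorphism \<open>f\<close> of \<open>S\<close> is either \<open>g \<circ> \<pi> p\<close> or obtained by
  gluing.
\<close>

lemma SH_exponent_agree_on_ptors:
  assumes S: "subgroup S G" "tors G \<subseteq> S" and p: "Factorial_Ring.prime p"
    and g: "g \<in> hom (p_torsion_group G p) (p_torsion_group G p)"
    and f: "\<And>x. x \<in> ptors G p \<Longrightarrow> f x = g x"
    and exponent: "SH_exponent (G\<lparr>carrier := S\<rparr>) f n"
  shows "SH_exponent (p_torsion_group G p) g n"
proof -
  have gc: "(g ^^ i) x \<in> ptors G p" if "x \<in> ptors G p" for i x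
    using hom_in_carrier[OF hom_funpow[OF g, of i] that] .
  have pow: "(f ^^ i) x = (g ^^ i) x" if "x \<in> ptors G p" for i x
    using that by (induction i) (simp_all add: f gc)
  have "(g ^^ n) ` ptors G p \<subseteq> (f ^^ n) ` S"
  proof (rule image_subsetI)
    fix x assume x: "x \<in> ptors G p"
    then have "x \<in> S" using ptors_subset_tors[OF p] S(2) by blast
    with pow[OF x] show "(g ^^ n) x \<in> (f ^^ n) ` S" by (metis imageI)
  qed
  then have "inj_on f ((g ^^ n) ` ptors G p)"
    using exponent by (auto simp: SH_exponent_def intro: inj_on_subset)
  moreover have "inj_on f ((g ^^ n) ` ptors G p) = inj_on g ((g ^^ n) ` ptors G p)"
    using f gc by (intro inj_on_cong) blast
  ultimately have "inj_on g ((g ^^ n) ` ptors G p)" by blast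
  then show ?thesis using exponent by (simp add: SH_exponent_def)
qed

lemma tors_of_components:
  assumes "finite F" "\<And>p. p \<in> F \<Longrightarrow> Factorial_Ring.prime p \<and> y p \<in> ptors G p"
  shows "\<exists>z \<in> tors G. \<forall>q. Factorial_Ring.prime q \<longrightarrow> \<pi> q z = (if q \<in> F then y q else \<one>)"
  using assms
proof (induction F rule: finite_induct)
  case empty
  show ?case using subgroup.one_closed[OF subgroup_tors] by (intro bexI[of _ \<one>]) (auto simp: proj_one)
next
  case (insert p F)
  then obtain z where z: "z \<in> tors G"
      "\<And>q. Factorial_Ring.prime q \<Longrightarrow> \<pi> q z = (if q \<in> F then y q else \<one>)" by auto
  have p: "Factorial_Ring.prime p" "y p \<in> ptors G p" using insert.prems by auto
  then have yT: "y p \<in> tors G" using ptors_subset_tors by blast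
  have c: "z \<in> carrier G" "y p \<in> carrier G" using z yT by (auto simp: tors_iff)
  have q_c: "y q \<in> carrier G" if "q \<in> insert p F" for q
    using insert.prems[OF that] by (auto simp: ptors_iff)
  have "\<pi> q (z \<otimes> y p) = (if q \<in> insert p F then y q else \<one>)" if q: "Factorial_Ring.prime q" for q
  proof (cases "q = p")
    case True
    then show ?thesis using insert.hyps c z(2)[OF q] proj_id p by (simp add: proj_mult q)
  next
    case False
    then show ?thesis using c z(2)[OF q] q_c proj_other_prime[OF q p(1) _ p(2)] by (simp add: proj_mult q)
  qed
  moreover have "z \<otimes> y p \<in> tors G" using z yT subgroup.m_closed[OF subgroup_tors] by blast
  ultimately show ?case by blast
qed

text \<open>
  The torsion subgroup is the direct sum of its primary parts: \<open>\<pi> p x\<close> is nontrivial only for the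
  primes that divide the order of \<open>x\<close>, so the element with components \<open>g p (\<pi> p x)\<close> exists.
\<close>

lemma glue_primary_endomorphisms:
  assumes g: "\<And>p. Factorial_Ring.prime p \<Longrightarrow> g p \<in> hom (p_torsion_group G p) (p_torsion_group G p)"
  obtains f where "f \<in> hom (torsion_group G) (torsion_group G)"
    "\<And>p x. Factorial_Ring.prime p \<Longrightarrow> x \<in> ptors G p \<Longrightarrow> f x = g p x"
proof -
  have gt: "g p x \<in> ptors G p" if "Factorial_Ring.prime p" "x \<in> ptors G p" for p x
    using hom_in_carrier[OF g] that by blast
  have g1: "g p \<one> = \<one>" if "Factorial_Ring.prime p" for p
    using endomorphism_one[OF subgroup_ptors[of p], of "g p"] g[OF that] by (simp flip: p_torsion_group_eq)
  have tc: "x \<in> carrier G" if "x \<in> tors G" for x using that by (simp add: tors_iff)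
  have "\<exists>y \<in> tors G. \<forall>p. Factorial_Ring.prime p \<longrightarrow> \<pi> p y = g p (\<pi> p x)" if x: "x \<in> tors G" for x
  proof -
    obtain n :: nat where n: "n > 0" "x [^] n = \<one>" using x by (auto simp: tors_iff)
    define F where "F = {p. Factorial_Ring.prime p \<and> p dvd n}"
    have "finite F" using n(1) by (auto simp: F_def intro: finite_subset[OF _ finite_divisors_nat])
    moreover have "Factorial_Ring.prime p \<and> g p (\<pi> p x) \<in> ptors G p" if "p \<in> F" for p
      using that gt proj_ptors tc[OF x] unfolding F_def by blast
    ultimately obtain y where y: "y \<in> tors G"
        "\<And>q. Factorial_Ring.prime q \<Longrightarrow> \<pi> q y = (if q \<in> F then g q (\<pi> q x) else \<one>)"
      using tors_of_components[of F "\<lambda>p. g p (\<pi> p x)"] by blast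
    have "\<pi> q x = \<one>" if "Factorial_Ring.prime q" "q \<notin> F" for q
      using that n(2) by (intro proj_coprime_order[OF that(1) tc[OF x]]) (auto simp: F_def prime_imp_coprime)
    then show ?thesis using y g1 by metis
  qed
  then obtain f where f: "\<And>x. x \<in> tors G \<Longrightarrow> f x \<in> tors G"
      "\<And>x p. x \<in> tors G \<Longrightarrow> Factorial_Ring.prime p \<Longrightarrow> \<pi> p (f x) = g p (\<pi> p x)"
    by metis
  have "f (x \<otimes> y) = f x \<otimes> f y" if x: "x \<in> tors G" and y: "y \<in> tors G" for x y
  proof (rule proj_ext)
    have xy: "x \<otimes> y \<in> tors G" using x y subgroup.m_closed[OF subgroup_tors] by blast
    then show "f (x \<otimes> y) \<in> carrier G" using f(1) tc by blast
    show "f x \<otimes> f y \<in> carrier G" using x y f(1) tc by blast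
    fix p :: nat assume p: "Factorial_Ring.prime p"
    have "g p (\<pi> p x \<otimes> \<pi> p y) = g p (\<pi> p x) \<otimes> g p (\<pi> p y)"
      using hom_mult[OF g[OF p] proj_ptors[OF p tc[OF x]] proj_ptors[OF p tc[OF y]]]
      by (simp add: p_torsion_group_def)
    then show "\<pi> p (f (x \<otimes> y)) = \<pi> p (f x \<otimes> f y)"
      using p x y xy f tc by (simp add: proj_mult)
  qed
  then have "f \<in> hom (torsion_group G) (torsion_group G)"
    using f(1) by (subst (1 2) torsion_group_eq) (simp add: hom_def)
  moreover have "f x = g p x" if p: "Factorial_Ring.prime p" and x: "x \<in> ptors G p" for p x
  proof (rule proj_ext)
    have xT: "x \<in> tors G" using ptors_subset_tors[OF p] x by blast
    then show "f x \<in> carrier G" using f(1) tc by blast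
    have gx: "g p x \<in> ptors G p" using gt[OF p x] .
    then show "g p x \<in> carrier G" by (simp add: ptors_iff)
    fix q :: nat assume q: "Factorial_Ring.prime q"
    show "\<pi> q (f x) = \<pi> q (g p x)"
    proof (cases "q = p")
      case True
      then show ?thesis using f(2)[OF xT q] proj_id[OF p x] proj_id[OF p gx] by simp
    next
      case False
      then show ?thesis
        using f(2)[OF xT q] proj_other_prime[OF q p _ x] proj_other_prime[OF q p _ gx] g1[OF q] by simp
    qed
  qed
  ultimately show ?thesis using that by blast
qed

lemma strongly_Hopfian_torsion_imp_bounded:
  assumes SH: "strongly_Hopfian (torsion_group G)" and p: "Factorial_Ring.prime p"
  obtains k where "\<And>x. x \<in> ptors G p \<Longrightarrow> x [^] (p ^ k) = \<one>"
proof -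
  interpret T: group "torsion_group G"
    using subgroup_imp_group[OF subgroup_tors] by (simp flip: torsion_group_eq)
  let ?f = "\<lambda>x. x [^] p"
  have tc: "x \<in> carrier G" if "x \<in> tors G" for x using that by (simp add: tors_iff)
  have powT: "x [^] (m::nat) \<in> tors G" if "x \<in> tors G" for x m
    using subgroup_int_pow_closed[OF subgroup_tors that, of "int m"] by (simp add: int_pow_int)
  have f: "?f \<in> hom (torsion_group G) (torsion_group G)"
    using powT tc by (subst (1 2) torsion_group_eq) (auto simp: hom_def nat_pow_distrib)
  have fpow: "(?f ^^ m) x = x [^] (p ^ m)" if "x \<in> carrier G" for m x
    using that by (induction m) (simp_all add: nat_pow_pow mult.commute)
  obtain n where "SH_exponent (torsion_group G) ?f n"
    using SH f by (auto simp: strongly_Hopfian_def)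
  then have ker: "x [^] (p ^ n) = \<one>" if "x \<in> tors G" "x [^] (p ^ Suc n) = \<one>" for x
    using that tc[OF that(1)] fpow[of x n] fpow[of x "Suc n"]
    unfolding T.SH_exponent_iff_kernels[OF f] by (auto simp: torsion_group_def)
  have "x [^] (p ^ n) = \<one>" if "x [^] (p ^ (n + i)) = \<one>" "x \<in> tors G" for x i
    using that
  proof (induction i arbitrary: x)
    case (Suc i)
    have "(x [^] p) [^] (p ^ (n + i)) = \<one>"
      using Suc.prems tc by (simp add: nat_pow_pow)
    from Suc.IH[OF this powT[OF Suc.prems(2)]] have "x [^] (p ^ Suc n) = \<one>"
      using Suc.prems tc by (simp add: nat_pow_pow)
    with ker Suc.prems show ?case by blast
  qed simp
  moreover have "\<exists>i. x [^] (p ^ (n + i)) = \<one>" if x: "x \<in> ptors G p" for x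
  proof -
    obtain k where k: "x \<in> carrier G" "x [^] (p ^ k) = \<one>" using x by (auto simp: ptors_iff)
    then have "(x [^] (p ^ k)) [^] (p ^ n) = \<one>" by simp
    then have "x [^] (p ^ (n + k)) = \<one>" using k(1) by (simp add: nat_pow_pow power_add mult.commute)
    then show ?thesis by blast
  qed
  ultimately show ?thesis using that ptors_subset_tors[OF p] by blast
qed

lemma strongly_Hopfian_torsion_imp_uniform_primary_exponent:
  assumes SH: "strongly_Hopfian (torsion_group G)"
  obtains n where "\<And>p g. Factorial_Ring.prime p \<Longrightarrow>
    g \<in> hom (p_torsion_group G p) (p_torsion_group G p) \<Longrightarrow> SH_exponent (p_torsion_group G p) g n"
proof -
  note T = subgroup_tors subset_refl
  \<comment> \<open>In each primary part some endomorphism requires the largest exponent.\<close>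
  have worst: "\<exists>g \<in> hom (p_torsion_group G p) (p_torsion_group G p). \<forall>n.
      SH_exponent (p_torsion_group G p) g n \<longrightarrow>
      (\<forall>h \<in> hom (p_torsion_group G p) (p_torsion_group G p). SH_exponent (p_torsion_group G p) h n)"
    if p: "Factorial_Ring.prime p" for p
  proof -
    let ?P = "p_torsion_group G p"
    interpret P: comm_group ?P
    proof -
      interpret P: group ?P by (rule group_p_torsion_group)
      show "comm_group ?P"
        by (rule P.group_comm_groupI) (simp add: p_torsion_group_def m_comm)
    qed
    obtain k where k: "\<And>x. x \<in> ptors G p \<Longrightarrow> x [^] (p ^ k) = \<one>"
      using strongly_Hopfian_torsion_imp_bounded[OF SH p] by blast
    have "strongly_Hopfian ?P"
      unfolding strongly_Hopfian_def
    proof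
      fix g assume g: "g \<in> hom ?P ?P"
      have "g \<circ> \<pi> p \<in> hom (torsion_group G) (torsion_group G)"
        using comp_proj_hom[OF T p g] by (simp flip: torsion_group_eq)
      then obtain n where "SH_exponent (torsion_group G) (g \<circ> \<pi> p) n"
        using SH by (auto simp: strongly_Hopfian_def)
      then have "SH_exponent ?P g n"
        using SH_exponent_agree_on_ptors[OF T p g, of "g \<circ> \<pi> p" n] proj_id[OF p]
        by (simp flip: torsion_group_eq)
      then show "\<exists>n. SH_exponent ?P g n" ..
    qed
    then have "finite (carrier ?P)"
      using k by (intro P.bounded_strongly_Hopfian_imp_finite[OF p, of k])
        (simp_all add: p_torsion_group_def flip: nat_pow_consistent)
    then have "uniformly_strongly_Hopfian ?P"
      by (intro finite_group_uniformly_strongly_Hopfian P.is_group)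
    then have ex: "\<exists>n. \<forall>h \<in> hom ?P ?P. SH_exponent ?P h n"
      by (simp add: uniformly_strongly_Hopfian_def)
    \<comment> \<open>\<open>e\<close> is the least uniform exponent, so some \<open>g\<close> violates \<open>e - 1\<close>; if \<open>e = 1\<close> every \<open>g\<close> does, as
      exponents are positive.\<close>
    define e where "e = (LEAST n. \<forall>h \<in> hom ?P ?P. SH_exponent ?P h n)"
    have e: "\<forall>h \<in> hom ?P ?P. SH_exponent ?P h e"
      unfolding e_def using ex by (rule LeastI_ex)
    have "(\<lambda>x. x) \<in> hom ?P ?P" by (simp add: hom_def)
    with e have "e > 0" by (auto simp: SH_exponent_def)
    then have "\<not> (\<forall>h \<in> hom ?P ?P. SH_exponent ?P h (e - 1))"
      unfolding e_def by (intro not_less_Least) simp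
    then obtain g where g: "g \<in> hom ?P ?P" "\<not> SH_exponent ?P g (e - 1)" by blast
    have "SH_exponent ?P h n" if "SH_exponent ?P g n" "h \<in> hom ?P ?P" for n h
    proof -
      have "e \<le> n"
        using SH_exponent_mono[OF g(1) that(1), of "e - 1"] g(2) by linarith
      with e that show ?thesis using SH_exponent_mono by blast
    qed
    with g(1) show ?thesis by blast
  qed
  then obtain g where g: "\<And>p. Factorial_Ring.prime p \<Longrightarrow> g p \<in> hom (p_torsion_group G p) (p_torsion_group G p)"
    and g_worst: "\<And>p n h. Factorial_Ring.prime p \<Longrightarrow> SH_exponent (p_torsion_group G p) (g p) n \<Longrightarrow>
      h \<in> hom (p_torsion_group G p) (p_torsion_group G p) \<Longrightarrow> SH_exponent (p_torsion_group G p) h n"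
    by metis
  obtain f where f: "f \<in> hom (torsion_group G) (torsion_group G)"
    "\<And>p x. Factorial_Ring.prime p \<Longrightarrow> x \<in> ptors G p \<Longrightarrow> f x = g p x"
    using glue_primary_endomorphisms[of g] g by blast
  obtain n where "SH_exponent (torsion_group G) f n"
    using SH f(1) by (auto simp: strongly_Hopfian_def)
  then have n: "SH_exponent (G\<lparr>carrier := tors G\<rparr>) f n"
    by (subst torsion_group_eq[symmetric])
  have "SH_exponent (p_torsion_group G p) (g p) n" if p: "Factorial_Ring.prime p" for p
    using SH_exponent_agree_on_ptors[OF T p g[OF p] f(2)[OF p] n] .
  with g_worst that show ?thesis by blast
qed

theorem uniformly_strongly_Hopfian_iff_torsion:
  "uniformly_strongly_Hopfian G \<longleftrightarrow> strongly_Hopfian (torsion_group G)"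
  "uniformly_strongly_Hopfian G \<longleftrightarrow> uniformly_strongly_Hopfian (torsion_group G)"
proof -
  have Gc: "subgroup (carrier G) G" "tors G \<subseteq> carrier G"
    by (auto simp: subgroup_self tors_iff)
  have 1: "uniformly_strongly_Hopfian (torsion_group G)" if unif: "uniformly_strongly_Hopfian G"
  proof -
    obtain n where n: "\<And>f. f \<in> hom G G \<Longrightarrow> SH_exponent G f n"
      using unif by (auto simp: uniformly_strongly_Hopfian_def)
    have "SH_exponent (p_torsion_group G p) g n"
      if p: "Factorial_Ring.prime p" and g: "g \<in> hom (p_torsion_group G p) (p_torsion_group G p)" for p g
      using SH_exponent_agree_on_ptors[OF Gc p g, of "g \<circ> \<pi> p" n] proj_id[OF p]
        comp_proj_hom[OF Gc p g] n by simp
    then have "SH_exponent (torsion_group G) f n" if "f \<in> hom (torsion_group G) (torsion_group G)" for f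
      using that SH_exponent_of_primary[OF subgroup_tors subset_refl, of f n]
        endomorphism_proj_tors[OF subgroup_tors subset_refl, of f] by (simp flip: torsion_group_eq)
    then show ?thesis by (auto simp: uniformly_strongly_Hopfian_def)
  qed
  have 2: "strongly_Hopfian (torsion_group G)" if "uniformly_strongly_Hopfian (torsion_group G)"
    using that by (auto simp: uniformly_strongly_Hopfian_def strongly_Hopfian_def)
  have 3: "uniformly_strongly_Hopfian G" if SH: "strongly_Hopfian (torsion_group G)"
  proof -
    obtain n where n: "\<And>p g. Factorial_Ring.prime p \<Longrightarrow>
        g \<in> hom (p_torsion_group G p) (p_torsion_group G p) \<Longrightarrow> SH_exponent (p_torsion_group G p) g n"
      using strongly_Hopfian_torsion_imp_uniform_primary_exponent[OF SH] by blast
    have "SH_exponent G f n" if f: "f \<in> hom G G" for f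
    proof -
      have "\<pi> p (f x) = f (\<pi> p x)" if p: "Factorial_Ring.prime p" and x: "x \<in> carrier G" for p x
        using strongly_Hopfian_torsion_imp_bounded[OF SH p] endomorphism_proj[OF f p x] by metis
      with SH_exponent_of_primary[OF Gc, of f n] f n show ?thesis by simp
    qed
    then show ?thesis by (auto simp: uniformly_strongly_Hopfian_def)
  qed
  show "uniformly_strongly_Hopfian G \<longleftrightarrow> strongly_Hopfian (torsion_group G)"
    "uniformly_strongly_Hopfian G \<longleftrightarrow> uniformly_strongly_Hopfian (torsion_group G)"
    using 1 2 3 by blast+
qed

end

section \<open>Projections of an sp-group\<close>

text \<open>
  The coordinate \<open>e p x\<close> of the image of \<open>x\<close> in the product is an element of the \<open>p\<close>-torsion subgroup of
  \<open>G\<close>, but on that subgroup \<open>e p\<close> is merely an automorphism, not the identity. The projection \<open>\<pi> p x\<close> is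
  therefore defined by pulling back the family whose only nontrivial coordinate is \<open>e p x\<close>; such a
  family has finite support and so belongs to the image of \<open>G\<close>.
\<close>

lemma (in comm_group) sp_group_imp_primary_projections:
  assumes "sp_group G"
  obtains \<pi> where "primary_projections G \<pi>"
proof -
  define I where "I = {p :: nat. Factorial_Ring.prime p}"
  define P where "P = product_group I (p_torsion_group G)"
  define T where "T = carrier (sum_group I (p_torsion_group G))"
  obtain G' where G': "subgroup G' P" "T \<subseteq> G'" "divisible_group (P\<lparr>carrier := G'\<rparr> Mod T)"
      and iso: "G \<cong> P\<lparr>carrier := G'\<rparr>"
    using assms unfolding sp_group_def Let_def P_def T_def I_def by blast
  obtain h where "h \<in> iso G (P\<lparr>carrier := G'\<rparr>)"
    using iso by (auto simp: is_iso_def)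
  then have h_hom': "h \<in> hom G (P\<lparr>carrier := G'\<rparr>)" and inj: "inj_on h (carrier G)"
    and img: "h ` carrier G = G'"
    by (auto simp: iso_def bij_betw_def)
  interpret P: group P
    unfolding P_def by (intro product_group group_p_torsion_group)
  have one_p_torsion_group: "\<one>\<^bsub>p_torsion_group G p\<^esub> = \<one>" for p
    by (simp add: p_torsion_group_def)
  have carrP: "carrier P = (\<Pi>\<^sub>E p\<in>I. ptors G p)" by (simp add: P_def)
  have T_eq: "T = {z \<in> carrier P. finite {p \<in> I. z p \<noteq> \<one>}}"
    unfolding T_def carrP carrier_sum_group[OF group_p_torsion_group] one_p_torsion_group ..
  have h_hom: "h \<in> hom G P"
    using h_hom' subgroup.subset[OF G'(1)] by (auto simp: hom_def)
  have hP: "h x \<in> carrier P" if "x \<in> carrier G" for x using hom_in_carrier[OF h_hom that] .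
  define e where "e p x = h x p" for p x
  have e_ptors: "e p x \<in> ptors G p" if "p \<in> I" "x \<in> carrier G" for p x
    using hP[OF that(2)] that(1) by (auto simp: carrP e_def)
  have e_carr: "e p x \<in> carrier G" if "p \<in> I" "x \<in> carrier G" for p x
    using e_ptors[OF that] by (simp add: ptors_iff)
  have e_mult: "e p (x \<otimes> y) = e p x \<otimes> e p y" if "p \<in> I" "x \<in> carrier G" "y \<in> carrier G" for p x y
    using hom_mult[OF h_hom that(2,3)] that(1) by (simp add: e_def P_def p_torsion_group_def)
  have e_hom: "e p \<in> hom G G" if "p \<in> I" for p
    using e_carr e_mult that by (auto simp: hom_def)
  have e_one: "e p \<one> = \<one>" if "p \<in> I" for p
    using hom_one[OF e_hom[OF that] is_group is_group] .
  have e_pow: "e p (x [^] (n::nat)) = e p x [^] n" if "p \<in> I" "x \<in> carrier G" for p x n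
    using hom_nat_pow[OF e_hom[OF that(1)] that(2) is_group is_group] .
  have e_ext: "x = y" if x: "x \<in> carrier G" and y: "y \<in> carrier G"
    and eq: "\<And>p. p \<in> I \<Longrightarrow> e p x = e p y" for x y
  proof -
    have "h x = h y"
      using hP[OF x] hP[OF y] eq unfolding carrP e_def by (rule PiE_ext)
    then show ?thesis using inj x y by (auto dest: inj_onD)
  qed
  have "\<exists>y \<in> carrier G. \<forall>q \<in> I. e q y = (if q = p then e p x else \<one>)"
    if p: "p \<in> I" and x: "x \<in> carrier G" for p x
  proof -
    define z where "z = (\<lambda>q\<in>I. if q = p then e p x else \<one>)"
    have "z \<in> carrier P"
      using e_ptors[OF p x] subgroup.one_closed[OF subgroup_ptors] by (auto simp: z_def carrP)
    moreover have "finite {q \<in> I. z q \<noteq> \<one>}"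
      by (rule finite_subset[of _ "{p}"]) (auto simp: z_def split: if_splits)
    ultimately have "z \<in> h ` carrier G" using G'(2) img by (auto simp: T_eq)
    then obtain y where "y \<in> carrier G" "h y = z" by auto
    then show ?thesis by (intro bexI[of _ y]) (auto simp: e_def z_def)
  qed
  then obtain \<pi> where \<pi>_carr: "\<And>p x. p \<in> I \<Longrightarrow> x \<in> carrier G \<Longrightarrow> \<pi> p x \<in> carrier G"
    and e_\<pi>: "\<And>p x q. p \<in> I \<Longrightarrow> x \<in> carrier G \<Longrightarrow> q \<in> I \<Longrightarrow> e q (\<pi> p x) = (if q = p then e p x else \<one>)"
    by metis
  have ePow: "\<exists>k. e p x [^] (p ^ k) = \<one>" if "p \<in> I" "x \<in> carrier G" for p x
    using e_ptors[OF that] by (auto simp: ptors_iff)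
  have "primary_projections G \<pi>"
  proof (intro primary_projections.intro primary_projections_axioms.intro comm_group_axioms)
    fix p :: nat assume "Factorial_Ring.prime p"
    then have p: "p \<in> I" by (simp add: I_def)
    show "\<pi> p \<in> hom G G"
    proof (rule homI)
      show "\<pi> p x \<in> carrier G" if "x \<in> carrier G" for x using \<pi>_carr[OF p that] .
      show "\<pi> p (x \<otimes> y) = \<pi> p x \<otimes> \<pi> p y" if "x \<in> carrier G" "y \<in> carrier G" for x y
        by (rule e_ext) (use that p in \<open>auto simp: \<pi>_carr e_\<pi> e_mult e_carr\<close>)
    qed
    show "\<pi> p x \<in> ptors G p" if x: "x \<in> carrier G" for x
    proof -
      obtain k where "e p x [^] (p ^ k) = \<one>" using ePow[OF p x] by blast
      note k = this
      have "\<pi> p x [^] (p ^ k) = \<one>"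
        by (rule e_ext) (use x p k in \<open>auto simp: \<pi>_carr e_\<pi> e_pow e_one\<close>)
      then show ?thesis using \<pi>_carr[OF p x] by (auto simp: ptors_iff)
    qed
    show "\<pi> p x = x" if "x \<in> ptors G p" for x
    proof -
      obtain k where x: "x \<in> carrier G" "x [^] (p ^ k) = \<one>" using \<open>x \<in> ptors G p\<close> by (auto simp: ptors_iff)
      have "e q x = \<one>" if q: "q \<in> I" "q \<noteq> p" for q
      proof -
        obtain l where "e q x [^] (q ^ l) = \<one>" using ePow[OF q(1) x(1)] by blast
        moreover have "e q x [^] (p ^ k) = \<one>" using e_pow[OF q(1) x(1), of "p ^ k"] x(2) e_one[OF q(1)] by simp
        moreover have "coprime (q ^ l) (p ^ k)"
          using q p by (simp add: I_def primes_coprime)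
        ultimately show ?thesis using coprime_pows_eq_one[OF e_carr[OF q(1) x(1)]] by blast
      qed
      note others = this
      show ?thesis
        by (rule e_ext) (use x p others in \<open>auto simp: \<pi>_carr e_\<pi>\<close>)
    qed
  next
    fix x assume x: "x \<in> carrier G" and eq: "\<And>p. Factorial_Ring.prime p \<Longrightarrow> \<pi> p x = \<one>"
    show "x = \<one>"
    proof (rule e_ext[OF x one_closed])
      fix p assume p: "p \<in> I"
      then have "\<pi> p x = \<one>" using eq by (simp add: I_def)
      then show "e p x = e p \<one>" using e_\<pi>[OF p x p] by simp
    qed
  next
    fix x and n :: nat assume x: "x \<in> carrier G" and n: "n > 0"
    define H where "H = P\<lparr>carrier := G'\<rparr>"
    have H: "carrier H = G'" "(\<otimes>\<^bsub>H\<^esub>) = (\<otimes>\<^bsub>P\<^esub>)" by (simp_all add: H_def)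
    have powH: "u [^]\<^bsub>H\<^esub> m = u [^]\<^bsub>P\<^esub> m" for u and m :: nat
      by (simp add: H_def flip: P.nat_pow_consistent)
    interpret H: group H unfolding H_def by (rule P.subgroup_imp_group[OF G'(1)])
    have "subgroup T P"
      using subgroup_sum_group[of I "p_torsion_group G", OF group_p_torsion_group]
      by (simp add: T_eq carrP one_p_torsion_group flip: P_def)
    then have subT: "subgroup T H"
      unfolding H_def using P.subgroup_incl G'(1,2) by blast
    have "comm_group H"
    proof (rule H.group_comm_groupI)
      fix u v assume "u \<in> carrier H" "v \<in> carrier H"
      then obtain a b where "a \<in> carrier G" "u = h a" "b \<in> carrier G" "v = h b"
        using img H by auto
      then show "u \<otimes>\<^bsub>H\<^esub> v = v \<otimes>\<^bsub>H\<^esub> u"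
        using m_comm[of a b] hom_mult[OF h_hom, of a b] hom_mult[OF h_hom, of b a] H by simp
    qed
    then interpret N: normal T H
      using subT by (simp add: comm_group.normal_iff_subgroup)
    have hx: "h x \<in> carrier H" using x img H by auto
    then have "T #>\<^bsub>H\<^esub> h x \<in> carrier (H Mod T)"
      by (auto simp: carrier_FactGroup)
    then obtain Y where Y: "Y \<in> carrier (H Mod T)" "Y [^]\<^bsub>H Mod T\<^esub> n = T #>\<^bsub>H\<^esub> h x"
      using G'(3) n unfolding divisible_group_def H_def by blast
    then obtain w where w: "w \<in> carrier H" "Y = T #>\<^bsub>H\<^esub> w"
      by (auto simp: carrier_FactGroup)
    have "h x \<in> T #>\<^bsub>H\<^esub> h x"
      using hx subT by (intro H.rcos_self)
    also have "\<dots> = T #>\<^bsub>H\<^esub> (w [^]\<^bsub>H\<^esub> n)"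
      using Y(2) N.FactGroup_pow[OF w(1)] w(2) by simp
    finally obtain t where t: "t \<in> T" "h x = t \<otimes>\<^bsub>P\<^esub> (w [^]\<^bsub>P\<^esub> n)"
      by (auto simp: r_coset_def H powH)
    have "w \<in> h ` carrier G" "t \<in> h ` carrier G"
      using w(1) t(1) G'(2) unfolding H(1) img by auto
    then obtain y s where y: "y \<in> carrier G" "w = h y" and s: "s \<in> carrier G" "t = h s"
      by (elim imageE)
    have "h x = h (s \<otimes> y [^] n)"
      using y s t(2) by (simp add: hom_mult[OF h_hom] hom_nat_pow[OF h_hom _ is_group P.is_group])
    then have xs: "x = y [^] n \<otimes> s"
      using inj x y s by (auto dest: inj_onD simp: m_comm)
    have "s \<in> tors G"
    proof -
      define F where "F = {p \<in> I. e p s \<noteq> \<one>}"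
      have F: "finite F" using t(1) by (simp add: T_eq F_def e_def s(2))
      obtain k where k: "\<And>p. p \<in> I \<Longrightarrow> e p s [^] (p ^ k p) = \<one>"
        using ePow[OF _ s(1)] by metis
      define N where "N = (\<Prod>p\<in>F. p ^ k p)"
      have "N > 0" unfolding N_def by (intro prod_pos) (auto simp: F_def I_def prime_gt_0_nat)
      moreover have "s [^] N = \<one>"
      proof (rule e_ext)
        fix p assume p: "p \<in> I"
        have "e p s [^] N = \<one>"
        proof (cases "p \<in> F")
          case True
          then obtain m where "N = p ^ k p * m" using F unfolding N_def by (metis dvd_prodI dvdE)
          then show ?thesis using pow_mult_eq_one[OF e_carr[OF p s(1)] k[OF p]] by simp
        qed (simp add: F_def p)
        then show "e p (s [^] N) = e p \<one>" using p s(1) by (simp add: e_pow e_one)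
      qed (use s in auto)
      ultimately show ?thesis using s(1) by (auto simp: tors_iff)
    qed
    with xs y show "\<exists>y \<in> carrier G. \<exists>t \<in> tors G. x = y [^] n \<otimes> t" by blast
  qed
  then show ?thesis using that by blast
qed

section \<open>Uniformly strongly Hopfian sp-groups\<close>

theorem proposition2p18:
  fixes G :: "('a, 'b) monoid_scheme"
  assumes "comm_group G" and "reduced_group G" and "sp_group G"
  shows "(uniformly_strongly_Hopfian G \<longleftrightarrow> strongly_Hopfian (torsion_group G)) \<and>
         (uniformly_strongly_Hopfian G \<longleftrightarrow> uniformly_strongly_Hopfian (torsion_group G))"
proof -
  obtain \<pi> where "primary_projections G \<pi>"
    using comm_group.sp_group_imp_primary_projections[OF assms(1,3)] by blast
  then show ?thesis
    using primary_projections.uniformly_strongly_Hopfian_iff_torsion by blast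
qed

end
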